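(* The following assertion is false: "for every finite monoid $M$ such that the Cartan matrix of the monoid algebra $\mathbb{C}M$ is non-singular, the Cartan matrix of $kM$ is non-singular for every field $k$." Equivalently, there exist a finite monoid $M$ and a field $k$ such that the Cartan matrix of $\mathbb{C}M$ is non-singular, but the Cartan matrix of $kM$ is singular.
   Context: For a field $k$ and a finite monoid $M$, $kM$ denotes the monoid algebra: the $k$-vector space with basis $M$ and multiplication extending that of $M$ bilinearly. The Cartan matrix of a finite-dimensional algebra $A$ over a field is the square matrix with rows and columns indexed by the isomorphism classes of simple $A$-modules, whose entry $C_{S,T}$ is the multiplicity of $S$ as a composition factor of the projective cover of $T$. A Cartan matrix is an integer matrix; it is called singular or non-singular according to whether its determinant (as an integer) is zero or non-zero. *)

theory Defs
  imports
    "HOL-Algebra.Algebraic_Closure_Type"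
    "HOL-Algebra.Module"
    "HOL-Algebra.QuotRing"
    "HOL-Library.FuncSet"
    "Jordan_Normal_Form.Determinant"
begin

text \<open>The monoid algebra of a finite monoid \<open>M\<close>: the basis element \<open>m\<close> is the indicator
  function of \<open>m\<close>, and multiplication is convolution.\<close>

definition monoid_algebra ::
    "('k, 'r) ring_scheme \<Rightarrow> ('m, 's) monoid_scheme \<Rightarrow> ('k, 'm \<Rightarrow> 'k) module" where
  "monoid_algebra K M =
    \<lparr>carrier = carrier M \<rightarrow>\<^sub>E carrier K,
     monoid.mult = (\<lambda>f g. \<lambda>x\<in>carrier M.
       \<Oplus>\<^bsub>K\<^esub>p\<in>{p \<in> carrier M \<times> carrier M. fst p \<otimes>\<^bsub>M\<^esub> snd p = x}. f (fst p) \<otimes>\<^bsub>K\<^esub> g (snd p)),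
     monoid.one = (\<lambda>x\<in>carrier M. if x = \<one>\<^bsub>M\<^esub> then \<one>\<^bsub>K\<^esub> else \<zero>\<^bsub>K\<^esub>),
     ring.zero = (\<lambda>x\<in>carrier M. \<zero>\<^bsub>K\<^esub>),
     ring.add = (\<lambda>f g. \<lambda>x\<in>carrier M. f x \<oplus>\<^bsub>K\<^esub> g x),
     module.smult = (\<lambda>c f. \<lambda>x\<in>carrier M. c \<otimes>\<^bsub>K\<^esub> f x)\<rparr>"

text \<open>The locale \<^locale>\<open>module\<close> requires a commutative ring, so left modules over an arbitrary
  unital ring are introduced here; they reuse the record \<open>module\<close>, whose fields \<open>mult\<close> and
  \<open>one\<close> are ignored.\<close>

locale left_module = A: ring A + V: abelian_group V
  for A :: "('a, 'r) ring_scheme" and V :: "('a, 'v, 's) module_scheme" +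
  assumes smult_closed:
      "\<lbrakk>a \<in> carrier A; x \<in> carrier V\<rbrakk> \<Longrightarrow> a \<odot>\<^bsub>V\<^esub> x \<in> carrier V"
    and smult_l_distr:
      "\<lbrakk>a \<in> carrier A; b \<in> carrier A; x \<in> carrier V\<rbrakk> \<Longrightarrow>
       (a \<oplus>\<^bsub>A\<^esub> b) \<odot>\<^bsub>V\<^esub> x = a \<odot>\<^bsub>V\<^esub> x \<oplus>\<^bsub>V\<^esub> b \<odot>\<^bsub>V\<^esub> x"
    and smult_r_distr:
      "\<lbrakk>a \<in> carrier A; x \<in> carrier V; y \<in> carrier V\<rbrakk> \<Longrightarrow>
       a \<odot>\<^bsub>V\<^esub> (x \<oplus>\<^bsub>V\<^esub> y) = a \<odot>\<^bsub>V\<^esub> x \<oplus>\<^bsub>V\<^esub> a \<odot>\<^bsub>V\<^esub> y"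
    and smult_assoc:
      "\<lbrakk>a \<in> carrier A; b \<in> carrier A; x \<in> carrier V\<rbrakk> \<Longrightarrow>
       (a \<otimes>\<^bsub>A\<^esub> b) \<odot>\<^bsub>V\<^esub> x = a \<odot>\<^bsub>V\<^esub> (b \<odot>\<^bsub>V\<^esub> x)"
    and smult_one: "x \<in> carrier V \<Longrightarrow> \<one>\<^bsub>A\<^esub> \<odot>\<^bsub>V\<^esub> x = x"

definition lmod_hom ::
    "('a, 'r) ring_scheme \<Rightarrow> ('a, 'v) module \<Rightarrow> ('a, 'w) module \<Rightarrow> ('v \<Rightarrow> 'w) set" where
  "lmod_hom A V W =
    {f \<in> hom (add_monoid V) (add_monoid W).
      \<forall>a\<in>carrier A. \<forall>x\<in>carrier V. f (a \<odot>\<^bsub>V\<^esub> x) = a \<odot>\<^bsub>W\<^esub> f x}"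

definition lmod_iso ::
    "('a, 'r) ring_scheme \<Rightarrow> ('a, 'v) module \<Rightarrow> ('a, 'w) module \<Rightarrow> bool" where
  "lmod_iso A V W \<longleftrightarrow> (\<exists>f\<in>lmod_hom A V W. bij_betw f (carrier V) (carrier W))"

text \<open>The quotient module \<open>V / U\<close>; on a coset \<open>Y\<close> of a submodule \<open>U\<close> the union below is the
  single coset of \<open>a \<odot> x\<close> for any \<open>x \<in> Y\<close>.\<close>

definition quotient_lmod :: "('a, 'v) module \<Rightarrow> 'v set \<Rightarrow> ('a, 'v set) module" where
  "quotient_lmod V U =
    \<lparr>carrier = a_rcosets\<^bsub>V\<^esub> U, monoid.mult = undefined, monoid.one = undefined,
     ring.zero = U, ring.add = set_add V,
     module.smult = (\<lambda>a Y. \<Union>x\<in>Y. U +>\<^bsub>V\<^esub> (a \<odot>\<^bsub>V\<^esub> x))\<rparr>"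

definition simple_lmod :: "('a, 'r) ring_scheme \<Rightarrow> ('a, 'v) module \<Rightarrow> bool" where
  "simple_lmod A V \<longleftrightarrow> left_module A V \<and> carrier V \<noteq> {\<zero>\<^bsub>V\<^esub>} \<and>
    (\<forall>U. submodule U A V \<longrightarrow> U = {\<zero>\<^bsub>V\<^esub>} \<or> U = carrier V)"

text \<open>The test modules have carriers of type \<open>('b \<Rightarrow> 'a) set\<close>. The free module on the set
  \<open>carrier P\<close> and all its quotients have copies of this type, in particular a free module
  mapping onto \<open>P\<close> and a copy of \<open>P\<close> itself, so this lifting property implies the one
  for modules with carriers of arbitrary type.\<close>

definition projective_lmod :: "('a, 'r) ring_scheme \<Rightarrow> ('a, 'b) module \<Rightarrow> bool" where
  "projective_lmod A P \<longleftrightarrow> left_module A P \<and>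
    (\<forall>(N :: ('a, ('b \<Rightarrow> 'a) set) module) (L :: ('a, ('b \<Rightarrow> 'a) set) module) g h.
      left_module A N \<and> left_module A L \<and>
      g \<in> lmod_hom A N L \<and> g ` carrier N = carrier L \<and> h \<in> lmod_hom A P L \<longrightarrow>
      (\<exists>h'\<in>lmod_hom A P N. \<forall>x\<in>carrier P. g (h' x) = h x))"

text \<open>\<open>P\<close> is a projective cover of \<open>T\<close>: it is projective and maps onto \<open>T\<close> with
  superfluous kernel.\<close>

definition projective_cover ::
    "('a, 'r) ring_scheme \<Rightarrow> ('a, 'b) module \<Rightarrow> ('a, 'v) module \<Rightarrow> bool" where
  "projective_cover A P T \<longleftrightarrow> projective_lmod A P \<and>
    (\<exists>f\<in>lmod_hom A P T. f ` carrier P = carrier T \<and>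
      (\<forall>U. submodule U A P \<and> a_kernel P T f <+>\<^bsub>P\<^esub> U = carrier P \<longrightarrow> U = carrier P))"

definition composition_factor :: "('a, 'v) module \<Rightarrow> 'v set list \<Rightarrow> nat \<Rightarrow> ('a, 'v set) module" where
  "composition_factor V Us i = quotient_lmod (V\<lparr>carrier := Us ! Suc i\<rparr>) (Us ! i)"

definition composition_series ::
    "('a, 'r) ring_scheme \<Rightarrow> ('a, 'v) module \<Rightarrow> 'v set list \<Rightarrow> bool" where
  "composition_series A V Us \<longleftrightarrow>
    left_module A V \<and> Us \<noteq> [] \<and> hd Us = {\<zero>\<^bsub>V\<^esub>} \<and> last Us = carrier V \<and>
    (\<forall>U\<in>set Us. submodule U A V) \<and>
    (\<forall>i. Suc i < length Us \<longrightarrow>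
      Us ! i \<subseteq> Us ! Suc i \<and> simple_lmod A (composition_factor V Us i))"

text \<open>\<open>S\<close> occurs \<open>m\<close> times as a composition factor of \<open>V\<close>. By the Jordan-Hoelder theorem
  \<open>m\<close> does not depend on the composition series.\<close>

definition has_multiplicity ::
    "('a, 'r) ring_scheme \<Rightarrow> ('a, 'v) module \<Rightarrow> ('a, 'w) module \<Rightarrow> nat \<Rightarrow> bool" where
  "has_multiplicity A V S m \<longleftrightarrow>
    (\<exists>Us. composition_series A V Us \<and>
      m = card {i. Suc i < length Us \<and> lmod_iso A (composition_factor V Us i) S})"

text \<open>\<open>Ss\<close> contains exactly one module from each isomorphism class of simple modules. Every
  simple module is isomorphic to \<open>A / I\<close> for a maximal left ideal \<open>I\<close>, so it has a copy
  whose carrier is of type \<open>'a set\<close>.\<close>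

definition simple_representatives ::
    "('a, 'r) ring_scheme \<Rightarrow> ('a, 'a set) module list \<Rightarrow> bool" where
  "simple_representatives A Ss \<longleftrightarrow>
    (\<forall>S\<in>set Ss. simple_lmod A S) \<and>
    (\<forall>i<length Ss. \<forall>j<length Ss. lmod_iso A (Ss ! i) (Ss ! j) \<longrightarrow> i = j) \<and>
    (\<forall>S :: ('a, 'a set) module. simple_lmod A S \<longrightarrow> (\<exists>T\<in>set Ss. lmod_iso A S T))"

text \<open>\<open>C\<close> is the Cartan matrix of the finite-dimensional algebra \<open>A\<close> with respect to some
  enumeration of the isomorphism classes of simple modules; it is thus determined up to
  simultaneous permutation of rows and columns, which does not affect the determinant.
  The projective cover of a simple module is isomorphic to a left ideal of \<open>A\<close>, so it has a
  copy whose carrier is of type \<open>'a\<close>.\<close>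

definition cartan_matrix :: "('a, 'r) ring_scheme \<Rightarrow> int mat \<Rightarrow> bool" where
  "cartan_matrix A C \<longleftrightarrow>
    (\<exists>Ss. simple_representatives A Ss \<and> C \<in> carrier_mat (length Ss) (length Ss) \<and>
      (\<forall>i<length Ss. \<forall>j<length Ss. \<exists>(P :: ('a, 'a) module) m.
        projective_cover A P (Ss ! j) \<and> has_multiplicity A P (Ss ! i) m \<and>
        C $$ (i, j) = int m))"

end

theory Submission
  imports Defs "HOL-Number_Theory.Residues"
begin

text \<open>Let \<open>M = {1, g, f, x\<^sub>1, x\<^sub>2, y, 0}\<close> where \<open>g\<^sup>2 = 1\<close>, \<open>g\<close> acts as the identity on
  \<open>f, x\<^sub>1, x\<^sub>2, y, 0\<close> from both sides, \<open>f\<^sup>2 = f\<close>, \<open>f x\<^sub>i = x\<^sub>i\<close>, \<open>y f = y\<close>, and all other products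
  of nonidentity elements are \<open>0\<close>. Over a field of characteristic other than \<open>2\<close> the element
  \<open>1 - f\<close> splits into \<open>(1 + g)/2 - f\<close> and \<open>(1 - g)/2\<close>; there are four simple modules, and apart
  from two blocks \<open>(1)\<close> the Cartan matrix consists of the block with rows \<open>(1, 2)\<close> and \<open>(1, 1)\<close>,
  whose determinant is \<open>-1\<close>. In characteristic \<open>2\<close> the idempotent \<open>1 - f\<close> is primitive and its
  projective module gains the composition factor spanned by \<open>g - 1\<close>, which turns the block into
  the singular one with rows \<open>(1, 2)\<close> and \<open>(1, 2)\<close>. In both cases the simple modules are
  one-dimensional and the radical has square zero, so that
  the simple modules, the projective covers \<open>A e\<close> and their composition series can be read off
  from characters, idempotents and flags of linear functionals.\<close>

text \<open>A group alone cannot serve: the Cartan matrix of its complex group algebra is the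
  identity, and in characteristic \<open>p\<close> the Cartan determinant is a power of
  \<open>p\<close>. So a group of order 2 is linked in both directions with an idempotent
  \<open>f\<close>. With \<open>a\<close> elements of kind \<open>x\<close> and \<open>b\<close> of
  kind \<open>y\<close>, the interesting block has rows \<open>(1, a)\<close> and
  \<open>(b, 1)\<close> as long as the trivial and the sign character of \<open>{1, g}\<close>
  differ. In characteristic 2 they coincide, and the two projectives belonging to them merge into
  one that has the factors of both, so one diagonal entry grows to 2. The determinants
  \<open>1 - a b\<close> and \<open>2 - a b\<close> call for \<open>a b = 2\<close>, hence two
  \<open>x\<close> and one \<open>y\<close>. The element \<open>0\<close> supplies a value for the
  vanishing products, at the price of one more simple module. Since \<open>g\<close> fixes every
  \<open>x\<close> and \<open>y\<close>, the element \<open>g - 1\<close> annihilates them, and its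
  square is \<open>2 - 2 g\<close>; this is why the radical still has square zero in characteristic
  2.\<close>

section \<open>Left modules: submodules, transport and quotients\<close>

lemma left_module_restrict:
  fixes V :: "('a, 'v) module"
  assumes V: "left_module A V" and U: "submodule U A V"
  shows "left_module A (V\<lparr>carrier := U\<rparr>)"
proof -
  interpret V: left_module A V by fact
  interpret U: submodule U A V by fact
  have "abelian_group (V\<lparr>carrier := U\<rparr>)"
  proof (rule abelian_groupI, goal_cases)
    case (6 x)
    then show ?case
      using U.m_inv_closed[of x] V.V.l_neg[of x] U.subset by (auto simp: a_inv_def[symmetric])
  qed (use U.subset U.m_closed U.one_closed V.V.a_assoc V.V.a_comm V.V.l_zero in \<open>auto simp: subset_iff\<close>)
  then show ?thesis
    unfolding left_module_def left_module_axioms_def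
    using V.A.ring_axioms V.smult_l_distr V.smult_r_distr V.smult_assoc V.smult_one U.smult_closed U.subset
    by (auto simp: subset_iff)
qed

text \<open>All module axioms concern elements that lift along the surjection \<open>F\<close>.
  Nothing is presupposed about the operations of \<open>Q\<close>, so this settles that
  \<open>quotient_lmod\<close> is a module without a separate calculus of cosets.\<close>

lemma left_module_transfer:
  fixes W :: "('a, 'w) module" and Q :: "('a, 'q) module"
  assumes W: "left_module A W" and F: "F ` carrier W = carrier Q" "F \<zero>\<^bsub>W\<^esub> = \<zero>\<^bsub>Q\<^esub>"
    and F_add: "\<And>x y. \<lbrakk>x \<in> carrier W; y \<in> carrier W\<rbrakk> \<Longrightarrow> F (x \<oplus>\<^bsub>W\<^esub> y) = F x \<oplus>\<^bsub>Q\<^esub> F y"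
    and F_smult: "\<And>a x. \<lbrakk>a \<in> carrier A; x \<in> carrier W\<rbrakk> \<Longrightarrow> F (a \<odot>\<^bsub>W\<^esub> x) = a \<odot>\<^bsub>Q\<^esub> F x"
  shows "left_module A Q"
proof -
  interpret W: left_module A W by fact
  note F_rev = F_add[symmetric] F_smult[symmetric] F(2)[symmetric]
  have rep: "\<exists>w\<in>carrier W. q = F w" if "q \<in> carrier Q" for q
    using that F(1) by auto
  have mem: "F w \<in> carrier Q" if "w \<in> carrier W" for w
    using that F(1) by auto
  have "abelian_group Q"
  proof (rule abelian_groupI, goal_cases)
    case (1 x y)
    then show ?case by (auto dest!: rep simp: F_rev intro!: mem)
  next
    case 2
    then show ?case by (auto simp: F_rev intro!: mem)
  next
    case (3 x y z)
    then show ?case by (auto dest!: rep simp: F_rev W.V.a_assoc)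
  next
    case (4 x y)
    then show ?case by (auto dest!: rep simp: F_rev W.V.a_comm)
  next
    case (5 x)
    then show ?case by (auto dest!: rep simp: F_rev)
  next
    case (6 x)
    then obtain w where w: "w \<in> carrier W" "x = F w" by (auto dest!: rep)
    then have "F (\<ominus>\<^bsub>W\<^esub> w) \<oplus>\<^bsub>Q\<^esub> x = \<zero>\<^bsub>Q\<^esub>"
      by (simp add: F_rev W.V.l_neg)
    with w show ?case by (auto intro!: mem)
  qed
  then show ?thesis
    unfolding left_module_def left_module_axioms_def F(1)[symmetric]
    using W.A.ring_axioms
    by (auto simp: F_rev W.smult_l_distr W.smult_r_distr W.smult_assoc W.smult_one W.smult_closed)
qed

lemma lmod_isoI:
  assumes "bij_betw F (carrier V) (carrier W)"
    and "\<And>x y. \<lbrakk>x \<in> carrier V; y \<in> carrier V\<rbrakk> \<Longrightarrow> F (x \<oplus>\<^bsub>V\<^esub> y) = F x \<oplus>\<^bsub>W\<^esub> F y"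
    and "\<And>a x. \<lbrakk>a \<in> carrier A; x \<in> carrier V\<rbrakk> \<Longrightarrow> F (a \<odot>\<^bsub>V\<^esub> x) = a \<odot>\<^bsub>W\<^esub> F x"
  shows "lmod_iso A V W"
  unfolding lmod_iso_def lmod_hom_def hom_def using assms bij_betwE[OF assms(1)] by auto

lemma lmod_homD:
  assumes "f \<in> lmod_hom A V W"
  shows "x \<in> carrier V \<Longrightarrow> f x \<in> carrier W"
    and "\<lbrakk>x \<in> carrier V; y \<in> carrier V\<rbrakk> \<Longrightarrow> f (x \<oplus>\<^bsub>V\<^esub> y) = f x \<oplus>\<^bsub>W\<^esub> f y"
    and "\<lbrakk>a \<in> carrier A; x \<in> carrier V\<rbrakk> \<Longrightarrow> f (a \<odot>\<^bsub>V\<^esub> x) = a \<odot>\<^bsub>W\<^esub> f x"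
  using assms unfolding lmod_hom_def hom_def by auto

lemma lmod_hom_zero:
  fixes V :: "('a, 'v) module" and W :: "('a, 'w) module"
  assumes "abelian_group V" "abelian_group W" "f \<in> lmod_hom A V W"
  shows "f \<zero>\<^bsub>V\<^esub> = \<zero>\<^bsub>W\<^esub>"
proof -
  interpret V: abelian_group V by fact
  interpret W: abelian_group W by fact
  show ?thesis
    using lmod_homD(1,2)[OF assms(3), of "\<zero>\<^bsub>V\<^esub>"] 
    by (metis V.zero_closed V.l_zero W.add.r_cancel_one' W.add.r_cancel_one)
qed

lemma lmod_iso_sym:
  assumes V: "left_module A V" and iso: "lmod_iso A V W"
  shows "lmod_iso A W V"
proof -
  interpret V: left_module A V by fact
  obtain f where f: "f \<in> lmod_hom A V W" and bij: "bij_betw f (carrier V) (carrier W)"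
    using iso unfolding lmod_iso_def by auto
  define g where "g = inv_into (carrier V) f"
  have img: "f ` carrier V = carrier W" using bij by (simp add: bij_betw_def)
  have gf: "g (f x) = x" if "x \<in> carrier V" for x
    using bij that by (simp add: g_def bij_betw_inv_into_left)
  show ?thesis
  proof (rule lmod_isoI[of g])
    show "bij_betw g (carrier W) (carrier V)"
      using bij by (simp add: g_def bij_betw_inv_into)
  qed (auto simp: img[symmetric] gf lmod_homD(2,3)[OF f, symmetric] V.smult_closed)
qed

lemma lmod_iso_trans:
  assumes "lmod_iso A V W" "lmod_iso A W Z"
  shows "lmod_iso A V Z"
proof -
  obtain f g where f: "f \<in> lmod_hom A V W" "bij_betw f (carrier V) (carrier W)"
    and g: "g \<in> lmod_hom A W Z" "bij_betw g (carrier W) (carrier Z)"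
    using assms unfolding lmod_iso_def by auto
  show ?thesis
    by (rule lmod_isoI[of "g \<circ> f"])
      (use f g in \<open>auto simp: lmod_homD(2,3)[OF f(1)] lmod_homD(2,3)[OF g(1)] lmod_homD(1)[OF f(1)]
        intro: bij_betw_trans\<close>)
qed

text \<open>The preimage of a submodule of \<open>W\<close> is a submodule of \<open>V\<close>,
  hence zero or everything, and bijectivity carries this back. That \<open>W\<close> is a module is
  a separate assumption because \<open>lmod_iso\<close> does not mention its zero.\<close>

lemma simple_lmod_iso:
  fixes V :: "('a, 'v) module" and W :: "('a, 'w) module"
  assumes V: "simple_lmod A V" and W: "left_module A W" and iso: "lmod_iso A V W"
  shows "simple_lmod A W"
proof -
  interpret V: left_module A V using V by (simp add: simple_lmod_def)
  interpret W: left_module A W by fact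
  obtain f where f: "f \<in> lmod_hom A V W" and bij: "bij_betw f (carrier V) (carrier W)"
    using iso unfolding lmod_iso_def by auto
  have img: "f ` carrier V = carrier W" and inj: "inj_on f (carrier V)"
    using bij by (auto simp: bij_betw_def)
  have f0: "f \<zero>\<^bsub>V\<^esub> = \<zero>\<^bsub>W\<^esub>"
    using lmod_hom_zero[OF V.V.abelian_group_axioms W.V.abelian_group_axioms f] .
  have nz: "carrier W \<noteq> {\<zero>\<^bsub>W\<^esub>}"
  proof
    assume "carrier W = {\<zero>\<^bsub>W\<^esub>}"
    then have "x = \<zero>\<^bsub>V\<^esub>" if "x \<in> carrier V" for x
      using that lmod_homD(1)[OF f, of x] f0 inj_onD[OF inj, of x "\<zero>\<^bsub>V\<^esub>"] by simp
    then have "carrier V = {\<zero>\<^bsub>V\<^esub>}" by auto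
    then show False using V by (simp add: simple_lmod_def)
  qed
  have "U = {\<zero>\<^bsub>W\<^esub>} \<or> U = carrier W" if U: "submodule U A W" for U
  proof -
    interpret U: submodule U A W by fact
    have neg: "f (\<ominus>\<^bsub>V\<^esub> x) = \<ominus>\<^bsub>W\<^esub> f x" if "x \<in> carrier V" for x
      using lmod_homD(2)[OF f, of "\<ominus>\<^bsub>V\<^esub> x" x] lmod_homD(1)[OF f] that f0
      by (metis V.V.a_inv_closed V.V.l_neg W.V.minus_equality)
    let ?U = "{x \<in> carrier V. f x \<in> U}"
    have "submodule ?U A V"
    proof (unfold_locales, goal_cases)
      case (4 x)
      then show ?case using neg[of x] U.m_inv_closed[of "f x"] by (simp add: a_inv_def[symmetric])
    next
      case (5 a x)
      then show ?case by (simp add: lmod_homD(3)[OF f] V.smult_closed U.smult_closed)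
    next
      case (2 x y)
      then show ?case using U.m_closed[of "f x" "f y"] by (simp add: lmod_homD(2)[OF f])
    next
      case 3
      then show ?case using U.one_closed f0 by simp
    qed auto
    then have "?U = {\<zero>\<^bsub>V\<^esub>} \<or> ?U = carrier V"
      using V by (simp add: simple_lmod_def)
    moreover have "U = f ` ?U"
      using U.subset img by auto
    ultimately show ?thesis using f0 img by auto
  qed
  with nz W show ?thesis by (simp add: simple_lmod_def)
qed

text \<open>The cosets of the kernel \<open>U\<close> are the fibres of \<open>f\<close>. The
  isomorphism runs from \<open>W\<close> to the quotient and sends \<open>w\<close> to its fibre; in
  this direction the same map also shows, by \<open>left_module_transfer\<close>, that the quotient
  is a module.\<close>

lemma quotient_lmod_iso:
  fixes V :: "('a, 'v) module" and W :: "('a, 'w) module"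
  assumes V: "left_module A V" and W: "left_module A W"
    and f: "f \<in> lmod_hom A V W" and surj: "f ` carrier V = carrier W"
    and U: "U = {x \<in> carrier V. f x = \<zero>\<^bsub>W\<^esub>}"
  shows "left_module A (quotient_lmod V U)" "lmod_iso A W (quotient_lmod V U)"
proof -
  interpret V: left_module A V by fact
  interpret W: left_module A W by fact
  define F where "F w = {x \<in> carrier V. f x = w}" for w
  have f0: "f \<zero>\<^bsub>V\<^esub> = \<zero>\<^bsub>W\<^esub>"
    using lmod_hom_zero[OF V.V.abelian_group_axioms W.V.abelian_group_axioms f] .
  note fD = lmod_homD[OF f]
  have neg: "f (\<ominus>\<^bsub>V\<^esub> x) = \<ominus>\<^bsub>W\<^esub> f x" if "x \<in> carrier V" for x
    using fD(2)[of "\<ominus>\<^bsub>V\<^esub> x" x] fD(1) that f0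
    by (metis V.V.a_inv_closed V.V.l_neg W.V.minus_equality)
  have coset: "U +>\<^bsub>V\<^esub> x = F (f x)" if x: "x \<in> carrier V" for x
  proof (rule Set.set_eqI, rule iffI)
    fix y assume "y \<in> U +>\<^bsub>V\<^esub> x"
    then show "y \<in> F (f x)"
      using x fD by (auto simp: a_r_coset_def' U F_def)
  next
    fix y assume y: "y \<in> F (f x)"
    then have "y \<oplus>\<^bsub>V\<^esub> \<ominus>\<^bsub>V\<^esub> x \<in> U"
      using x fD by (auto simp: U F_def neg W.V.r_neg)
    moreover have "y = (y \<oplus>\<^bsub>V\<^esub> \<ominus>\<^bsub>V\<^esub> x) \<oplus>\<^bsub>V\<^esub> x"
      using x y by (simp add: F_def V.V.a_assoc V.V.l_neg)
    ultimately show "y \<in> U +>\<^bsub>V\<^esub> x"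
      by (auto simp: a_r_coset_def')
  qed
  have img: "F ` carrier W = carrier (quotient_lmod V U)"
    using coset by (auto simp: quotient_lmod_def A_RCOSETS_def' surj[symmetric])
  have zero: "F \<zero>\<^bsub>W\<^esub> = \<zero>\<^bsub>quotient_lmod V U\<^esub>"
    by (simp add: F_def U quotient_lmod_def)
  have qadd: "B \<oplus>\<^bsub>quotient_lmod V U\<^esub> C = (\<Union>x\<in>B. \<Union>y\<in>C. {x \<oplus>\<^bsub>V\<^esub> y})" for B C
    by (simp add: quotient_lmod_def set_add_def')
  have add: "F (w \<oplus>\<^bsub>W\<^esub> w') = F w \<oplus>\<^bsub>quotient_lmod V U\<^esub> F w'"
    if w: "w \<in> carrier W" "w' \<in> carrier W" for w w'
  proof (rule Set.set_eqI, rule iffI)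
    fix y assume y: "y \<in> F (w \<oplus>\<^bsub>W\<^esub> w')"
    obtain x where x: "x \<in> carrier V" "w = f x" using w surj by auto
    \<comment> \<open>With \<open>x\<close> a preimage of \<open>w\<close>, the given
      \<open>y\<close> splits as \<open>x + (-x + y)\<close>, and the second summand lies over
      \<open>w'\<close>.\<close>
    have "x \<in> F w" "\<ominus>\<^bsub>V\<^esub> x \<oplus>\<^bsub>V\<^esub> y \<in> F w'"
      using x y w fD by (auto simp: F_def neg W.V.a_assoc[symmetric] W.V.l_neg)
    moreover have "y = x \<oplus>\<^bsub>V\<^esub> (\<ominus>\<^bsub>V\<^esub> x \<oplus>\<^bsub>V\<^esub> y)"
      using x y by (simp add: F_def V.V.a_assoc[symmetric] V.V.r_neg)
    ultimately show "y \<in> F w \<oplus>\<^bsub>quotient_lmod V U\<^esub> F w'"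
      unfolding qadd by blast
  qed (use w fD in \<open>auto simp: F_def qadd\<close>)
  have smult: "F (a \<odot>\<^bsub>W\<^esub> w) = a \<odot>\<^bsub>quotient_lmod V U\<^esub> F w"
    if "a \<in> carrier A" "w \<in> carrier W" for a w
  proof -
    \<comment> \<open>All cosets in the union are the fibre over \<open>a w\<close>, and the union
      is over a nonempty set because \<open>f\<close> is onto.\<close>
    have "(\<Union>x\<in>F w. U +>\<^bsub>V\<^esub> (a \<odot>\<^bsub>V\<^esub> x)) = (\<Union>x\<in>F w. F (a \<odot>\<^bsub>W\<^esub> w))"
      using that by (intro SUP_cong) (auto simp: coset V.smult_closed F_def fD)
    moreover have "F w \<noteq> {}" using that by (auto simp: F_def surj[symmetric])
    ultimately show ?thesis by (simp add: quotient_lmod_def)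
  qed
  show "left_module A (quotient_lmod V U)"
    by (rule left_module_transfer[OF W img zero add smult])
  have "inj_on F (carrier W)"
  proof (rule inj_onI)
    fix w w' assume "w \<in> carrier W" "w' \<in> carrier W" "F w = F w'"
    moreover from this obtain x where "x \<in> carrier V" "w = f x" using surj by auto
    ultimately show "w = w'" by (auto simp: F_def)
  qed
  then show "lmod_iso A W (quotient_lmod V U)"
    by (intro lmod_isoI[of F]) (auto simp: bij_betw_def img add smult)
qed

section \<open>Rings with radical square zero and one-dimensional simple modules\<close>

definition left_ideal_lmod :: "('a, 'r) ring_scheme \<Rightarrow> 'a set \<Rightarrow> ('a, 'a) module" where
  "left_ideal_lmod A I = \<lparr>carrier = I, monoid.mult = undefined, monoid.one = undefined,
     ring.zero = \<zero>\<^bsub>A\<^esub>, ring.add = ring.add A, module.smult = monoid.mult A\<rparr>"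

lemma (in ring) left_module_left_ideal:
  assumes "I \<subseteq> carrier R" "\<zero> \<in> I"
    and "\<And>x y. \<lbrakk>x \<in> I; y \<in> I\<rbrakk> \<Longrightarrow> x \<oplus> y \<in> I"
    and smult: "\<And>a x. \<lbrakk>a \<in> carrier R; x \<in> I\<rbrakk> \<Longrightarrow> a \<otimes> x \<in> I"
  shows "left_module R (left_ideal_lmod R I)"
proof -
  have "abelian_group (left_ideal_lmod R I)"
  proof (rule abelian_groupI, goal_cases)
    case (6 x)
    then have x: "x \<in> I" by (simp add: left_ideal_lmod_def)
    \<comment> \<open>Closure under negation comes from left multiplication by
      \<open>-1\<close>.\<close>
    then have "\<ominus> x \<in> I"
      using smult[of "\<ominus> \<one>" x] assms(1) by (auto simp: l_minus)
    with x show ?case using assms(1) by (auto simp: left_ideal_lmod_def intro!: bexI l_neg)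
  qed (use assms in \<open>auto simp: left_ideal_lmod_def subset_iff a_ac\<close>)
  then show ?thesis
    unfolding left_module_def left_module_axioms_def
    using assms ring_axioms
    by (auto simp: left_ideal_lmod_def subset_iff l_distr r_distr m_assoc)
qed

context left_module
begin

lemma smult_zero_left: "x \<in> carrier V \<Longrightarrow> \<zero>\<^bsub>A\<^esub> \<odot>\<^bsub>V\<^esub> x = \<zero>\<^bsub>V\<^esub>"
  by (metis A.l_zero A.zero_closed V.add.l_cancel_one' smult_closed smult_l_distr)

lemma smult_zero_right: "a \<in> carrier A \<Longrightarrow> a \<odot>\<^bsub>V\<^esub> \<zero>\<^bsub>V\<^esub> = \<zero>\<^bsub>V\<^esub>"
  by (metis V.l_zero V.zero_closed V.add.l_cancel_one' smult_closed smult_r_distr)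

lemma smult_minus_left:
  "\<lbrakk>a \<in> carrier A; x \<in> carrier V\<rbrakk> \<Longrightarrow> (\<ominus>\<^bsub>A\<^esub> a) \<odot>\<^bsub>V\<^esub> x = \<ominus>\<^bsub>V\<^esub> (a \<odot>\<^bsub>V\<^esub> x)"
  by (metis A.a_inv_closed A.l_neg V.minus_equality smult_closed smult_l_distr smult_zero_left)

lemma submoduleI:
  assumes "U \<subseteq> carrier V" "\<zero>\<^bsub>V\<^esub> \<in> U"
    and "\<And>x y. \<lbrakk>x \<in> U; y \<in> U\<rbrakk> \<Longrightarrow> x \<oplus>\<^bsub>V\<^esub> y \<in> U"
    and smult: "\<And>a x. \<lbrakk>a \<in> carrier A; x \<in> U\<rbrakk> \<Longrightarrow> a \<odot>\<^bsub>V\<^esub> x \<in> U"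
  shows "submodule U A V"
proof (unfold_locales, goal_cases)
  case (4 x)
  then show ?case
    using smult[of "\<ominus>\<^bsub>A\<^esub> \<one>\<^bsub>A\<^esub>" x] assms(1)
    by (auto simp: smult_minus_left smult_one a_inv_def[symmetric])
qed (use assms in auto)

end

text \<open>The common kernel of the characters \<open>\<chi> i\<close> stands in for the Jacobson
  radical, and the \<open>e i\<close> are dual to the characters. Here \<open>A\<close> is a ring
  without a chosen action of \<open>K\<close>; surjectivity of \<open>\<chi> i\<close> takes over
  the part of the scalars.\<close>

locale radical_square_zero_ring = A: ring A + K: field K
  for A :: "('a, 'r) ring_scheme" and K :: "('k, 's) ring_scheme" +
  fixes n :: nat and \<chi> :: "nat \<Rightarrow> 'a \<Rightarrow> 'k" and e :: "nat \<Rightarrow> 'a"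
  assumes chi_hom: "i < n \<Longrightarrow> \<chi> i \<in> Ring.ring_hom A K"
    and chi_surj: "i < n \<Longrightarrow> \<chi> i ` carrier A = carrier K"
    and e_closed: "i < n \<Longrightarrow> e i \<in> carrier A"
    and e_idem: "i < n \<Longrightarrow> e i \<otimes>\<^bsub>A\<^esub> e i = e i"
    and chi_e: "\<lbrakk>i < n; j < n\<rbrakk> \<Longrightarrow> \<chi> i (e j) = (if i = j then \<one>\<^bsub>K\<^esub> else \<zero>\<^bsub>K\<^esub>)"
    and radical_square_zero:
      "\<lbrakk>a \<in> carrier A; b \<in> carrier A; \<And>i. i < n \<Longrightarrow> \<chi> i a = \<zero>\<^bsub>K\<^esub>; \<And>i. i < n \<Longrightarrow> \<chi> i b = \<zero>\<^bsub>K\<^esub>\<rbrakk> \<Longrightarrow>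
       a \<otimes>\<^bsub>A\<^esub> b = \<zero>\<^bsub>A\<^esub>"
begin

abbreviation "A_lmod \<equiv> left_ideal_lmod A (carrier A)"

definition char_lmod :: "nat \<Rightarrow> ('a, 'k) module" where
  "char_lmod i = \<lparr>carrier = carrier K, monoid.mult = undefined, monoid.one = undefined,
     ring.zero = \<zero>\<^bsub>K\<^esub>, ring.add = ring.add K, module.smult = (\<lambda>a x. \<chi> i a \<otimes>\<^bsub>K\<^esub> x)\<rparr>"

text \<open>A copy of \<open>char_lmod i\<close> with the carrier type that
  \<open>simple_representatives\<close> prescribes; computations take place in
  \<open>char_lmod i\<close>.\<close>

definition simple :: "nat \<Rightarrow> ('a, 'a set) module" where
  "simple i = quotient_lmod A_lmod {a \<in> carrier A. \<chi> i a = \<zero>\<^bsub>K\<^esub>}"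

text \<open>As \<open>e j\<close> is idempotent, this is the left ideal \<open>A e j\<close>,
  described by an equation for its elements.\<close>

definition proj :: "nat \<Rightarrow> ('a, 'a) module" where
  "proj j = left_ideal_lmod A {a \<in> carrier A. a \<otimes>\<^bsub>A\<^esub> e j = a}"

lemma chi_closed: "\<lbrakk>i < n; a \<in> carrier A\<rbrakk> \<Longrightarrow> \<chi> i a \<in> carrier K"
  using chi_hom[of i] by (auto simp: Ring.ring_hom_def)

lemma chi_add: "\<lbrakk>i < n; a \<in> carrier A; b \<in> carrier A\<rbrakk> \<Longrightarrow> \<chi> i (a \<oplus>\<^bsub>A\<^esub> b) = \<chi> i a \<oplus>\<^bsub>K\<^esub> \<chi> i b"
  using chi_hom[of i] by (auto simp: Ring.ring_hom_def)

lemma chi_mult: "\<lbrakk>i < n; a \<in> carrier A; b \<in> carrier A\<rbrakk> \<Longrightarrow> \<chi> i (a \<otimes>\<^bsub>A\<^esub> b) = \<chi> i a \<otimes>\<^bsub>K\<^esub> \<chi> i b"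
  using chi_hom[of i] by (auto simp: Ring.ring_hom_def)

lemma chi_one: "i < n \<Longrightarrow> \<chi> i \<one>\<^bsub>A\<^esub> = \<one>\<^bsub>K\<^esub>"
  using chi_hom[of i] by (auto simp: Ring.ring_hom_def)

lemma chi_preimage:
  assumes "i < n" "c \<in> carrier K"
  obtains a where "a \<in> carrier A" "\<chi> i a = c"
  using assms chi_surj[of i] by (metis imageE)

lemma chi_zero: "i < n \<Longrightarrow> \<chi> i \<zero>\<^bsub>A\<^esub> = \<zero>\<^bsub>K\<^esub>"
  using Ring.ring_hom_zero[OF chi_hom[of i] A.ring_axioms K.ring_axioms] by simp

lemma chi_minus: "\<lbrakk>i < n; a \<in> carrier A\<rbrakk> \<Longrightarrow> \<chi> i (\<ominus>\<^bsub>A\<^esub> a) = \<ominus>\<^bsub>K\<^esub> \<chi> i a"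
  by (metis A.a_inv_closed A.l_neg K.minus_equality chi_add chi_closed chi_zero)

lemma left_module_A: "left_module A A_lmod"
  by (rule A.left_module_left_ideal) auto

lemma left_module_proj: "j < n \<Longrightarrow> left_module A (proj j)"
  unfolding proj_def
  by (rule A.left_module_left_ideal) (auto simp: e_closed A.l_distr A.m_assoc)

lemma left_module_char:
  assumes i: "i < n" shows "left_module A (char_lmod i)"
proof -
  have "abelian_group (char_lmod i)"
  proof (rule abelian_groupI, goal_cases)
    case (6 x)
    then show ?case by (auto simp: char_lmod_def intro!: bexI K.l_neg)
  qed (auto simp: char_lmod_def K.a_ac)
  then show ?thesis
    unfolding left_module_def left_module_axioms_def
    using A.ring_axioms i
    by (auto simp: char_lmod_def chi_closed chi_add chi_mult chi_one K.l_distr K.r_distr K.m_assoc)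
qed

text \<open>Since \<open>\<chi> i\<close> is onto, a submodule is stable under multiplication by all
  of \<open>K\<close>, and a field has only the two trivial ideals.\<close>

lemma simple_char:
  assumes i: "i < n" shows "simple_lmod A (char_lmod i)"
  unfolding simple_lmod_def
proof (intro conjI allI impI)
  show "carrier (char_lmod i) \<noteq> {\<zero>\<^bsub>char_lmod i\<^esub>}"
    using K.one_closed K.one_not_zero by (metis char_lmod_def partial_object.select_convs(1) ring.select_convs(1) singletonD)
  fix U assume "submodule U A (char_lmod i)"
  then interpret U: submodule U A "char_lmod i" .
  have sub: "U \<subseteq> carrier K" and zero: "\<zero>\<^bsub>K\<^esub> \<in> U"
    using U.subset U.one_closed by (auto simp: char_lmod_def)
  have smult: "\<chi> i a \<otimes>\<^bsub>K\<^esub> x \<in> U" if "a \<in> carrier A" "x \<in> U" for a x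
    using U.smult_closed[OF that] by (simp add: char_lmod_def)
  show "U = {\<zero>\<^bsub>char_lmod i\<^esub>} \<or> U = carrier (char_lmod i)"
  proof (cases "U = {\<zero>\<^bsub>K\<^esub>}")
    case False
    then obtain u where u: "u \<in> U" "u \<noteq> \<zero>\<^bsub>K\<^esub>" using zero by auto
    then have unit: "u \<in> Units K" using sub K.field_Units by auto
    have "c \<in> U" if c: "c \<in> carrier K" for c
    proof -
      obtain a where a: "a \<in> carrier A" "\<chi> i a = c \<otimes>\<^bsub>K\<^esub> inv\<^bsub>K\<^esub> u"
        using chi_preimage[OF i, of "c \<otimes>\<^bsub>K\<^esub> inv\<^bsub>K\<^esub> u"] c unit by auto
      show ?thesis using smult[OF a(1) u(1)] c unit K.Units_closed[OF unit] by (simp add: a(2) K.m_assoc)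
    qed
    then show ?thesis using sub by (auto simp: char_lmod_def)
  qed (simp add: char_lmod_def)
qed (rule left_module_char[OF i])

text \<open>For \<open>i \<noteq> j\<close> the idempotent \<open>e i\<close> is the identity on the
  first module and zero on the second, so every homomorphism between them vanishes.\<close>

lemma char_iso_eq:
  assumes i: "i < n" and j: "j < n" and iso: "lmod_iso A (char_lmod i) (char_lmod j)"
  shows "i = j"
proof (rule ccontr)
  assume "i \<noteq> j"
  obtain f where f: "f \<in> lmod_hom A (char_lmod i) (char_lmod j)" and "inj_on f (carrier K)"
    using iso by (auto simp: lmod_iso_def bij_betw_def char_lmod_def)
  have "f x = \<zero>\<^bsub>K\<^esub>" if x: "x \<in> carrier K" for x
    using lmod_homD(3)[OF f e_closed[OF i], of x] lmod_homD(1)[OF f, of x] x i j \<open>i \<noteq> j\<close>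
    by (simp add: char_lmod_def chi_e)
  then show False
    using \<open>inj_on f (carrier K)\<close> K.one_not_zero K.one_closed K.zero_closed by (metis inj_onD)
qed

lemma chi_lmod_hom: "i < n \<Longrightarrow> \<chi> i \<in> lmod_hom A A_lmod (char_lmod i)"
  by (auto simp: lmod_hom_def hom_def left_ideal_lmod_def char_lmod_def chi_closed chi_add chi_mult)

lemma
  assumes i: "i < n"
  shows left_module_simple: "left_module A (simple i)"
    and char_iso_simple: "lmod_iso A (char_lmod i) (simple i)"
proof -
  have *: "\<chi> i ` carrier A_lmod = carrier (char_lmod i)"
    using chi_surj[OF i] by (simp add: left_ideal_lmod_def char_lmod_def)
  have **: "{a \<in> carrier A. \<chi> i a = \<zero>\<^bsub>K\<^esub>} = {a \<in> carrier A_lmod. \<chi> i a = \<zero>\<^bsub>char_lmod i\<^esub>}"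
    by (simp add: left_ideal_lmod_def char_lmod_def)
  show "left_module A (simple i)" "lmod_iso A (char_lmod i) (simple i)"
    unfolding simple_def
    by (rule quotient_lmod_iso[OF left_module_A left_module_char[OF i] chi_lmod_hom[OF i] * **])+
qed

lemma simple_simple: "i < n \<Longrightarrow> simple_lmod A (simple i)"
  by (metis simple_lmod_iso simple_char left_module_simple char_iso_simple)

lemma char_iso_iff:
  fixes Q :: "('a, 'q) module"
  assumes i: "i < n" and j: "j < n" and "lmod_iso A (char_lmod i) Q" and "left_module A Q"
  shows "lmod_iso A Q (simple j) \<longleftrightarrow> i = j"
proof
  assume "lmod_iso A Q (simple j)"
  then have "lmod_iso A (char_lmod i) (char_lmod j)"
    using assms char_iso_simple[OF j] left_module_char[OF j] 
    by (metis lmod_iso_trans lmod_iso_sym)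
  then show "i = j" using char_iso_eq i j by blast
next
  assume "i = j"
  then show "lmod_iso A Q (simple j)"
    using assms char_iso_simple[OF j] left_module_char[OF i] by (metis lmod_iso_trans lmod_iso_sym)
qed

section \<open>Classification of the simple modules\<close>

text \<open>The sum \<open>s\<close> of all \<open>e i\<close> has value 1 under every character, so
  \<open>s - 1\<close> lies in the common kernel and kills \<open>t\<close>. If every
  \<open>e i\<close> killed \<open>t\<close>, so would \<open>s\<close>, and
  \<open>t = s t - (s - 1) t\<close> would be zero. The induction builds \<open>s\<close> through
  its partial sums.\<close>

lemma exists_idempotent_moving:
  fixes V :: "('a, 'v) module"
  assumes V: "left_module A V" and t: "t \<in> carrier V" "t \<noteq> \<zero>\<^bsub>V\<^esub>"
    and kill: "\<And>a. \<lbrakk>a \<in> carrier A; \<And>i. i < n \<Longrightarrow> \<chi> i a = \<zero>\<^bsub>K\<^esub>\<rbrakk> \<Longrightarrow> a \<odot>\<^bsub>V\<^esub> t = \<zero>\<^bsub>V\<^esub>"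
  shows "\<exists>i<n. e i \<odot>\<^bsub>V\<^esub> t \<noteq> \<zero>\<^bsub>V\<^esub>"
proof (rule ccontr)
  interpret V: left_module A V by fact
  assume "\<not> ?thesis"
  then have et: "e i \<odot>\<^bsub>V\<^esub> t = \<zero>\<^bsub>V\<^esub>" if "i < n" for i using that by auto
  have "\<exists>s\<in>carrier A. (\<forall>j<n. \<chi> j s = (if j < k then \<one>\<^bsub>K\<^esub> else \<zero>\<^bsub>K\<^esub>)) \<and> s \<odot>\<^bsub>V\<^esub> t = \<zero>\<^bsub>V\<^esub>"
    if "k \<le> n" for k
    using that
  proof (induction k)
    case 0
    show ?case using t by (auto simp: chi_zero V.smult_zero_left intro!: bexI[of _ "\<zero>\<^bsub>A\<^esub>"])
  next
    case (Suc k)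
    then obtain s where s: "s \<in> carrier A" "\<forall>j<n. \<chi> j s = (if j < k then \<one>\<^bsub>K\<^esub> else \<zero>\<^bsub>K\<^esub>)"
      "s \<odot>\<^bsub>V\<^esub> t = \<zero>\<^bsub>V\<^esub>" by auto
    show ?case
      using s Suc.prems t
      by (intro bexI[of _ "s \<oplus>\<^bsub>A\<^esub> e k"]) (auto simp: chi_add chi_e e_closed V.smult_l_distr et)
  qed
  from this[of n] obtain s where s: "s \<in> carrier A" "\<forall>j<n. \<chi> j s = \<one>\<^bsub>K\<^esub>" "s \<odot>\<^bsub>V\<^esub> t = \<zero>\<^bsub>V\<^esub>" by auto
  have "(s \<oplus>\<^bsub>A\<^esub> \<ominus>\<^bsub>A\<^esub> \<one>\<^bsub>A\<^esub>) \<odot>\<^bsub>V\<^esub> t = \<zero>\<^bsub>V\<^esub>"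
    using s by (intro kill) (auto simp: chi_add chi_minus chi_one K.r_neg)
  moreover have "(s \<oplus>\<^bsub>A\<^esub> \<ominus>\<^bsub>A\<^esub> \<one>\<^bsub>A\<^esub>) \<odot>\<^bsub>V\<^esub> t = \<ominus>\<^bsub>V\<^esub> t"
    using s t by (simp add: V.smult_l_distr V.smult_minus_left V.smult_one)
  ultimately show False using t V.V.add.inv_eq_1_iff[of t] by simp
qed

text \<open>A nonzero vector \<open>t\<close> killed by the radical is moved by some
  \<open>e i\<close>. Then \<open>u = e i t\<close> generates \<open>V\<close> by simplicity, and
  its annihilator is exactly the kernel of \<open>\<chi> i\<close>.\<close>

lemma simple_lmod_classification:
  fixes V :: "('a, 'v) module"
  assumes simple: "simple_lmod A V"
  shows "\<exists>i<n. lmod_iso A V (simple i)"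
proof -
  define rad where "rad = {a \<in> carrier A. \<forall>i<n. \<chi> i a = \<zero>\<^bsub>K\<^esub>}"
  interpret V: left_module A V using simple by (simp add: simple_lmod_def)
  \<comment> \<open>Either the radical kills all of \<open>V\<close>, or some \<open>a x\<close>
    with \<open>a\<close> radical is nonzero; the latter is itself killed, since products of two
    radical elements vanish.\<close>
  have "\<exists>t\<in>carrier V. t \<noteq> \<zero>\<^bsub>V\<^esub> \<and> (\<forall>a\<in>rad. a \<odot>\<^bsub>V\<^esub> t = \<zero>\<^bsub>V\<^esub>)"
  proof (cases "\<exists>a\<in>rad. \<exists>x\<in>carrier V. a \<odot>\<^bsub>V\<^esub> x \<noteq> \<zero>\<^bsub>V\<^esub>")
    case True
    then obtain a x where ax: "a \<in> rad" "x \<in> carrier V" "a \<odot>\<^bsub>V\<^esub> x \<noteq> \<zero>\<^bsub>V\<^esub>" by auto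
    have "b \<odot>\<^bsub>V\<^esub> (a \<odot>\<^bsub>V\<^esub> x) = \<zero>\<^bsub>V\<^esub>" if "b \<in> rad" for b
      using ax that radical_square_zero[of b a]
      by (simp add: rad_def V.smult_assoc[symmetric] V.smult_zero_left)
    with ax show ?thesis by (auto simp: rad_def V.smult_closed intro!: bexI[of _ "a \<odot>\<^bsub>V\<^esub> x"])
  next
    case False
    moreover obtain x where "x \<in> carrier V" "x \<noteq> \<zero>\<^bsub>V\<^esub>"
      using simple by (auto simp: simple_lmod_def)
    ultimately show ?thesis by auto
  qed
  then obtain t where t: "t \<in> carrier V" "t \<noteq> \<zero>\<^bsub>V\<^esub>" and kill: "\<And>a. a \<in> rad \<Longrightarrow> a \<odot>\<^bsub>V\<^esub> t = \<zero>\<^bsub>V\<^esub>"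
    by auto
  obtain i where i: "i < n" and et: "e i \<odot>\<^bsub>V\<^esub> t \<noteq> \<zero>\<^bsub>V\<^esub>"
    using exists_idempotent_moving[OF V.left_module_axioms t] kill by (auto simp: rad_def)
  define u where "u = e i \<odot>\<^bsub>V\<^esub> t"
  have u: "u \<in> carrier V" "u \<noteq> \<zero>\<^bsub>V\<^esub>" using et e_closed[OF i] t by (auto simp: u_def V.smult_closed)
  define f where "f a = a \<odot>\<^bsub>V\<^esub> u" for a
  have f: "f \<in> lmod_hom A A_lmod V"
    using u by (auto simp: f_def lmod_hom_def hom_def left_ideal_lmod_def
        V.smult_closed V.smult_l_distr V.smult_assoc)
  have "submodule (f ` carrier A) A V"
  proof (rule V.submoduleI)
    show "\<zero>\<^bsub>V\<^esub> \<in> f ` carrier A"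
      using u by (auto simp: f_def V.smult_zero_left intro!: image_eqI[of _ _ "\<zero>\<^bsub>A\<^esub>"])
  qed (use u in \<open>auto simp: f_def V.smult_closed V.smult_l_distr[symmetric] V.smult_assoc[symmetric]\<close>)
  moreover have "u \<in> f ` carrier A"
    using u by (auto simp: f_def V.smult_one intro!: image_eqI[of _ _ "\<one>\<^bsub>A\<^esub>"])
  ultimately have surj: "f ` carrier A_lmod = carrier V"
    using simple u by (auto simp: simple_lmod_def left_ideal_lmod_def)
  \<comment> \<open>\<open>a e i\<close> vanishes under every character: under
    \<open>\<chi> i\<close> because of \<open>a\<close>, under the others because of
    \<open>e i\<close>. So it is radical and kills \<open>t\<close>.\<close>
  have ker0: "f a = \<zero>\<^bsub>V\<^esub>" if a: "a \<in> carrier A" "\<chi> i a = \<zero>\<^bsub>K\<^esub>" for a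
  proof -
    have "a \<otimes>\<^bsub>A\<^esub> e i \<in> rad"
      using a i by (auto simp: rad_def e_closed chi_mult chi_e chi_closed)
    then show ?thesis
      using kill a i t by (simp add: f_def u_def V.smult_assoc[symmetric] e_closed)
  qed
  \<comment> \<open>If \<open>\<chi> i a\<close> had the inverse \<open>\<chi> i b\<close>, then
    \<open>b a - 1\<close> would kill \<open>u\<close> by the previous step; as \<open>b a\<close>
    kills \<open>u\<close> too, \<open>u\<close> would be zero.\<close>
  have "\<chi> i a = \<zero>\<^bsub>K\<^esub>" if a: "a \<in> carrier A" "f a = \<zero>\<^bsub>V\<^esub>" for a
  proof (rule ccontr)
    assume "\<chi> i a \<noteq> \<zero>\<^bsub>K\<^esub>"
    then have unit: "\<chi> i a \<in> Units K" using a i by (simp add: K.field_Units chi_closed)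
    then obtain b where b: "b \<in> carrier A" "\<chi> i b = inv\<^bsub>K\<^esub> \<chi> i a"
      using chi_preimage[OF i] K.Units_inv_closed by metis
    have "f (b \<otimes>\<^bsub>A\<^esub> a \<oplus>\<^bsub>A\<^esub> \<ominus>\<^bsub>A\<^esub> \<one>\<^bsub>A\<^esub>) = \<zero>\<^bsub>V\<^esub>"
      using a b i unit by (intro ker0) (auto simp: chi_add chi_mult chi_minus chi_one K.r_neg)
    moreover have "f (b \<otimes>\<^bsub>A\<^esub> a \<oplus>\<^bsub>A\<^esub> \<ominus>\<^bsub>A\<^esub> \<one>\<^bsub>A\<^esub>) = \<ominus>\<^bsub>V\<^esub> u"
      using a b u by (simp add: f_def V.smult_l_distr V.smult_minus_left V.smult_one V.smult_assoc
          V.smult_zero_right)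
    ultimately show False using u V.V.add.inv_eq_1_iff[of u] by simp
  qed
  with ker0 have "{a \<in> carrier A. \<chi> i a = \<zero>\<^bsub>K\<^esub>} = {a \<in> carrier A_lmod. f a = \<zero>\<^bsub>V\<^esub>}"
    by (auto simp: left_ideal_lmod_def)
  then show ?thesis
    using quotient_lmod_iso(2)[OF left_module_A V.left_module_axioms f surj] i
    by (auto simp: simple_def)
qed

lemma simple_representatives_simple: "simple_representatives A (map simple [0..<n])"
  unfolding simple_representatives_def
proof (intro conjI allI impI)
  fix i j assume *: "i < length (map simple [0..<n])" "j < length (map simple [0..<n])"
    "lmod_iso A (map simple [0..<n] ! i) (map simple [0..<n] ! j)"
  then show "i = j"
    using char_iso_iff[of i j "simple i"] char_iso_simple[of i] left_module_simple[of i] by simp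
next
  fix S :: "('a, 'a set) module" assume "simple_lmod A S"
  then show "\<exists>T\<in>set (map simple [0..<n]). lmod_iso A S T"
    using simple_lmod_classification[of S] by auto
qed (auto simp: simple_simple)

section \<open>Projective covers\<close>

text \<open>Because of \<open>x = x e j\<close>, a homomorphism on \<open>A e j\<close> is
  determined by the image of \<open>e j\<close>. Any preimage \<open>y\<close> of
  \<open>h (e j)\<close> under \<open>g\<close> yields the lift that sends \<open>x\<close> to
  \<open>x y\<close>.\<close>

lemma projective_proj:
  assumes j: "j < n" shows "projective_lmod A (proj j)"
  unfolding projective_lmod_def
proof (intro conjI allI impI)
  show "left_module A (proj j)" by (rule left_module_proj[OF j])
  fix N L :: "('a, ('a \<Rightarrow> 'a) set) module" and g h
  assume *: "left_module A N \<and> left_module A L \<and>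
      g \<in> lmod_hom A N L \<and> g ` carrier N = carrier L \<and> h \<in> lmod_hom A (proj j) L"
  then interpret N: left_module A N by simp
  have g: "g \<in> lmod_hom A N L" and h: "h \<in> lmod_hom A (proj j) L" using * by auto
  have e: "e j \<in> carrier (proj j)" by (simp add: proj_def left_ideal_lmod_def e_closed e_idem j)
  then have "h (e j) \<in> g ` carrier N" using * lmod_homD(1)[OF h] by simp
  then obtain y where y: "y \<in> carrier N" "g y = h (e j)" by auto
  show "\<exists>h'\<in>lmod_hom A (proj j) N. \<forall>x\<in>carrier (proj j). g (h' x) = h x"
  proof (intro bexI ballI)
    show "(\<lambda>x. x \<odot>\<^bsub>N\<^esub> y) \<in> lmod_hom A (proj j) N"
      using y by (auto simp: lmod_hom_def hom_def proj_def left_ideal_lmod_def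
        N.smult_closed N.smult_l_distr N.smult_assoc)
    fix x assume x: "x \<in> carrier (proj j)"
    then have "x \<in> carrier A" by (simp add: proj_def left_ideal_lmod_def)
    then have "g (x \<odot>\<^bsub>N\<^esub> y) = h (x \<odot>\<^bsub>proj j\<^esub> e j)"
      using y lmod_homD(3)[OF g, of x y] lmod_homD(3)[OF h _ e, of x] by simp
    also have "x \<odot>\<^bsub>proj j\<^esub> e j = x"
      using x by (simp add: proj_def left_ideal_lmod_def)
    finally show "g (x \<odot>\<^bsub>N\<^esub> y) = h x" .
  qed
qed

text \<open>Nakayama's lemma by hand: write \<open>e j = r + u\<close> with \<open>r\<close> in the
  kernel and \<open>u\<close> in \<open>U\<close>. Then \<open>r\<close> is radical, so
  \<open>r r = 0\<close>, whence \<open>r u = r e j = r\<close> and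
  \<open>(1 + r) u = u + r = e j\<close>. Thus \<open>U\<close> contains the generator.\<close>

lemma projective_cover_proj:
  assumes j: "j < n" shows "projective_cover A (proj j) (simple j)"
proof -
  interpret P: left_module A "proj j" by (rule left_module_proj[OF j])
  interpret S: left_module A "simple j" by (rule left_module_simple[OF j])
  obtain \<phi> where \<phi>: "\<phi> \<in> lmod_hom A (char_lmod j) (simple j)"
    and bij: "bij_betw \<phi> (carrier K) (carrier (simple j))"
    using char_iso_simple[OF j] by (auto simp: lmod_iso_def char_lmod_def)
  define f where "f = \<phi> \<circ> \<chi> j"
  have P: "carrier (proj j) = {a \<in> carrier A. a \<otimes>\<^bsub>A\<^esub> e j = a}"
    "ring.add (proj j) = ring.add A" "module.smult (proj j) = monoid.mult A"
    by (simp_all add: proj_def left_ideal_lmod_def)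
  have C: "carrier (char_lmod j) = carrier K" "ring.add (char_lmod j) = ring.add K" 
     "module.smult (char_lmod j) = (\<lambda>a x. \<chi> j a \<otimes>\<^bsub>K\<^esub> x)" "ring.zero (char_lmod j) = ring.zero K"
    by (simp_all add: char_lmod_def)
  have "f \<in> lmod_hom A (proj j) (simple j)"
    using lmod_homD[OF \<phi>] j
    by (auto simp: f_def lmod_hom_def hom_def P C chi_closed chi_add chi_mult)
  moreover have "f ` carrier (proj j) = carrier (simple j)"
  proof -
    have "c \<in> \<chi> j ` carrier (proj j)" if c: "c \<in> carrier K" for c
    proof -
      obtain a where a: "a \<in> carrier A" "\<chi> j a = c" by (rule chi_preimage[OF j c])
      then show ?thesis
        using j c by (intro image_eqI[of _ _ "a \<otimes>\<^bsub>A\<^esub> e j"])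
          (auto simp: P chi_mult chi_e e_closed A.m_assoc e_idem)
    qed
    then have "\<chi> j ` carrier (proj j) = carrier K"
      using j by (auto simp: P chi_closed)
    then show ?thesis
      using bij unfolding f_def image_comp[symmetric] by (simp add: bij_betw_def)
  qed
  moreover have "U = carrier (proj j)"
    if U: "submodule U A (proj j)" and sum: "a_kernel (proj j) (simple j) f <+>\<^bsub>proj j\<^esub> U = carrier (proj j)"
    for U
  proof -
    interpret U: submodule U A "proj j" by fact
    have "e j \<in> a_kernel (proj j) (simple j) f <+>\<^bsub>proj j\<^esub> U"
      using sum j by (simp add: P e_closed e_idem)
    then obtain r u where r: "r \<in> carrier A" "r \<otimes>\<^bsub>A\<^esub> e j = r" "f r = \<zero>\<^bsub>simple j\<^esub>" and u: "u \<in> U"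
      and eq: "e j = r \<oplus>\<^bsub>A\<^esub> u"
      by (auto simp: set_add_def' a_kernel_def' P)
    have u': "u \<in> carrier A" "u \<otimes>\<^bsub>A\<^esub> e j = u" using u U.subset by (auto simp: P)
    have "\<chi> j r = \<zero>\<^bsub>K\<^esub>"
    proof -
      have "\<phi> \<zero>\<^bsub>K\<^esub> = \<zero>\<^bsub>simple j\<^esub>"
        using lmod_hom_zero[OF _ S.V.abelian_group_axioms \<phi>] left_module_char[OF j]
        by (simp add: C left_module_def)
      then show ?thesis
        using r j inj_onD[OF bij_betw_imp_inj_on[OF bij], of "\<chi> j r" "\<zero>\<^bsub>K\<^esub>"]
        by (simp add: f_def chi_closed)
    qed
    \<comment> \<open>The equation \<open>r = r e j\<close> forces all characters other than
      \<open>\<chi> j\<close> to vanish on \<open>r\<close>.\<close>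
    moreover have "\<chi> i r = \<zero>\<^bsub>K\<^esub>" if "i < n" "i \<noteq> j" for i
      using chi_mult[of i r "e j"] that r j by (simp add: e_closed chi_e chi_closed)
    ultimately have rr: "r \<otimes>\<^bsub>A\<^esub> r = \<zero>\<^bsub>A\<^esub>"
      using r by (intro radical_square_zero) auto
    have re: "r \<otimes>\<^bsub>A\<^esub> u = r"
    proof -
      have "r = r \<otimes>\<^bsub>A\<^esub> (r \<oplus>\<^bsub>A\<^esub> u)" using r by (simp add: eq[symmetric])
      also have "\<dots> = r \<otimes>\<^bsub>A\<^esub> u" using r u' by (simp add: A.r_distr rr)
      finally show ?thesis by simp
    qed
    have "(\<one>\<^bsub>A\<^esub> \<oplus>\<^bsub>A\<^esub> r) \<otimes>\<^bsub>A\<^esub> u = e j"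
      using r u' by (simp add: A.l_distr re eq A.a_comm)
    then have "e j \<in> U"
      using U.smult_closed[of "\<one>\<^bsub>A\<^esub> \<oplus>\<^bsub>A\<^esub> r" u] r u by (simp add: P)
    then have "a \<in> U" if "a \<in> carrier (proj j)" for a
      using U.smult_closed[of a "e j"] that by (simp add: P)
    then show ?thesis using U.subset by auto
  qed
  ultimately show ?thesis
    unfolding projective_cover_def using projective_proj[OF j] by blast
qed

section \<open>Composition multiplicities from flags of functionals\<close>

text \<open>The flag is built from the bottom: \<open>U k\<close> is the common kernel of the
  functionals of index at least \<open>k\<close>, so \<open>U 0\<close> is zero and
  \<open>U m\<close> is \<open>V\<close>. On \<open>U (Suc k)\<close> the map \<open>h k\<close> is
  linear onto \<open>char_lmod (t k)\<close> with kernel \<open>U k\<close>. Hence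
  \<open>smult\<close> and \<open>dual\<close> speak of vectors on which the later functionals
  vanish: the action is triangular in these coordinates, not diagonal.\<close>

lemma has_multiplicity_flag:
  fixes V :: "('a, 'v) module" and h :: "nat \<Rightarrow> 'v \<Rightarrow> 'k"
  assumes V: "left_module A V" and i: "i < n"
    and t: "\<And>k. k < m \<Longrightarrow> t k < n"
    and closed: "\<And>k x. \<lbrakk>k < m; x \<in> carrier V\<rbrakk> \<Longrightarrow> h k x \<in> carrier K"
    and add: "\<And>k x y. \<lbrakk>k < m; x \<in> carrier V; y \<in> carrier V\<rbrakk> \<Longrightarrow> h k (x \<oplus>\<^bsub>V\<^esub> y) = h k x \<oplus>\<^bsub>K\<^esub> h k y"
    and smult: "\<And>k a x. \<lbrakk>k < m; a \<in> carrier A; x \<in> carrier V;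
        \<And>l. \<lbrakk>k < l; l < m\<rbrakk> \<Longrightarrow> h l x = \<zero>\<^bsub>K\<^esub>\<rbrakk> \<Longrightarrow> h k (a \<odot>\<^bsub>V\<^esub> x) = \<chi> (t k) a \<otimes>\<^bsub>K\<^esub> h k x"
    and faithful: "\<And>x. \<lbrakk>x \<in> carrier V; \<And>k. k < m \<Longrightarrow> h k x = \<zero>\<^bsub>K\<^esub>\<rbrakk> \<Longrightarrow> x = \<zero>\<^bsub>V\<^esub>"
    and dual: "\<And>k. k < m \<Longrightarrow> \<exists>b\<in>carrier V. h k b = \<one>\<^bsub>K\<^esub> \<and> (\<forall>l. k < l \<and> l < m \<longrightarrow> h l b = \<zero>\<^bsub>K\<^esub>)"
  shows "has_multiplicity A V (simple i) (card {k. k < m \<and> t k = i})"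
proof -
  interpret V: left_module A V by fact
  define U where "U k = {x \<in> carrier V. \<forall>l. k \<le> l \<and> l < m \<longrightarrow> h l x = \<zero>\<^bsub>K\<^esub>}" for k
  \<comment> \<open>\<open>m + 1\<close> submodules, so that the \<open>m\<close> factors are
    indexed by \<open>k < m\<close>.\<close>
  define Us where "Us = map U [0..<Suc m]"
  have nth: "Us ! k = U k" if "k \<le> m" for k using that by (simp add: Us_def nth_map_upt del: upt_Suc)
  have zero: "h k \<zero>\<^bsub>V\<^esub> = \<zero>\<^bsub>K\<^esub>" if "k < m" for k
    using add[OF that, of "\<zero>\<^bsub>V\<^esub>" "\<zero>\<^bsub>V\<^esub>"] closed[OF that, of "\<zero>\<^bsub>V\<^esub>"]
    by (metis K.add.l_cancel_one' V.V.l_zero V.V.zero_closed)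
  have sub: "submodule (U k) A V" for k
  proof (rule V.submoduleI)
    fix a x assume a: "a \<in> carrier A" and x: "x \<in> U k"
    have "h l (a \<odot>\<^bsub>V\<^esub> x) = \<zero>\<^bsub>K\<^esub>" if "k \<le> l" "l < m" for l
      using smult[OF that(2) a, of x] x that a t[OF that(2)] by (auto simp: U_def chi_closed)
    with a x show "a \<odot>\<^bsub>V\<^esub> x \<in> U k" by (auto simp: U_def V.smult_closed)
  qed (auto simp: U_def zero add)
  have factor: "left_module A (composition_factor V Us k)"
    "lmod_iso A (char_lmod (t k)) (composition_factor V Us k)" if k: "k < m" for k
  proof -
    let ?V = "V\<lparr>carrier := U (Suc k)\<rparr>"
    have hom: "h k \<in> lmod_hom A ?V (char_lmod (t k))"
      using k smult[OF k] by (auto simp: lmod_hom_def hom_def char_lmod_def U_def closed add Suc_le_eq)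
    obtain b where b: "b \<in> carrier V" "h k b = \<one>\<^bsub>K\<^esub>" "\<And>l. k < l \<Longrightarrow> l < m \<Longrightarrow> h l b = \<zero>\<^bsub>K\<^esub>"
      using dual[OF k] by blast
    have bU: "b \<in> U (Suc k)" using b by (auto simp: U_def)
    have surj: "h k ` carrier ?V = carrier (char_lmod (t k))"
    proof
      show "h k ` carrier ?V \<subseteq> carrier (char_lmod (t k))"
        by (rule image_subsetI, rule lmod_homD(1)[OF hom])
      show "carrier (char_lmod (t k)) \<subseteq> h k ` carrier ?V"
      proof
        fix c assume "c \<in> carrier (char_lmod (t k))"
        then have c: "c \<in> carrier K" by (simp add: char_lmod_def)
        then obtain a where a: "a \<in> carrier A" "\<chi> (t k) a = c"
          by (rule chi_preimage[OF t[OF k]])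
        have "h k (a \<odot>\<^bsub>V\<^esub> b) = c"
          using smult[OF k a(1) b(1)] b a c by simp
        moreover have "a \<odot>\<^bsub>V\<^esub> b \<in> U (Suc k)"
          using submodule.smult_closed[OF sub a(1) bU] .
        ultimately show "c \<in> h k ` carrier ?V" by auto
      qed
    qed
    have ker: "U k = {x \<in> carrier ?V. h k x = \<zero>\<^bsub>char_lmod (t k)\<^esub>}"
    proof -
      have "k \<le> l \<longleftrightarrow> l = k \<or> Suc k \<le> l" for l by auto
      then show ?thesis using k by (auto simp: U_def char_lmod_def)
    qed
    have "composition_factor V Us k = quotient_lmod ?V (U k)"
      using k by (simp add: composition_factor_def nth)
    then show "left_module A (composition_factor V Us k)"
      "lmod_iso A (char_lmod (t k)) (composition_factor V Us k)"
      using quotient_lmod_iso[OF left_module_restrict[OF V sub] left_module_char[OF t[OF k]] hom surj ker]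
      by simp_all
  qed
  have "composition_series A V Us"
    unfolding composition_series_def
  proof (intro conjI allI impI ballI)
    show "hd Us = {\<zero>\<^bsub>V\<^esub>}"
      using faithful zero by (auto simp: Us_def U_def hd_map simp del: upt_Suc)
    show "last Us = carrier V"
      by (auto simp: Us_def U_def)
    fix k assume "Suc k < length Us"
    then have k: "k < m" by (simp add: Us_def)
    then show "Us ! k \<subseteq> Us ! Suc k"
      by (auto simp: nth U_def)
    show "simple_lmod A (composition_factor V Us k)"
      using simple_lmod_iso[OF simple_char[OF t[OF k]] factor[OF k]] .
  qed (use V sub in \<open>auto simp: Us_def\<close>)
  moreover have "{k. Suc k < length Us \<and> lmod_iso A (composition_factor V Us k) (simple i)}
      = {k. k < m \<and> t k = i}"
    using char_iso_iff[OF t i factor(2,1)] by (auto simp: Us_def)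
  ultimately show ?thesis
    unfolding has_multiplicity_def by (intro exI[of _ Us]) simp
qed

lemma cartan_matrixI:
  assumes C: "C \<in> carrier_mat n n"
    and "\<And>i j. \<lbrakk>i < n; j < n\<rbrakk> \<Longrightarrow> \<exists>m. has_multiplicity A (proj j) (simple i) m \<and> C $$ (i, j) = int m"
  shows "cartan_matrix A C"
  unfolding cartan_matrix_def
proof (intro exI[of _ "map simple [0..<n]"] conjI allI impI)
  fix i j assume "i < length (map simple [0..<n])" "j < length (map simple [0..<n])"
  then have ij: "i < n" "j < n" by simp_all
  with assms(2) obtain m where "has_multiplicity A (proj j) (simple i) m" "C $$ (i, j) = int m"
    by blast
  with ij projective_cover_proj[of j]
  show "\<exists>(P :: ('a, 'a) module) m. projective_cover A P (map simple [0..<n] ! j) \<and>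
      has_multiplicity A P (map simple [0..<n] ! i) m \<and> C $$ (i, j) = int m"
    by (intro exI[of _ "proj j"] exI[of _ m]) simp
qed (use C simple_representatives_simple in simp_all)

text \<open>\<open>ts ! j\<close> lists the indices of the composition factors of
  \<open>proj j\<close> from bottom to top, and column \<open>j\<close> of the Cartan matrix counts
  them. Additivity of the functionals is asked on all of \<open>A\<close>, while the remaining
  conditions concern elements of \<open>A e j\<close>.\<close>

lemma cartan_matrix_flags:
  fixes h :: "nat \<Rightarrow> nat \<Rightarrow> 'a \<Rightarrow> 'k" and ts :: "nat list list"
  assumes t: "\<And>j k. \<lbrakk>j < n; k < length (ts ! j)\<rbrakk> \<Longrightarrow> ts ! j ! k < n"
    and closed: "\<And>j k x. \<lbrakk>j < n; k < length (ts ! j); x \<in> carrier A\<rbrakk> \<Longrightarrow> h j k x \<in> carrier K"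
    and add: "\<And>j k x y. \<lbrakk>j < n; k < length (ts ! j); x \<in> carrier A; y \<in> carrier A\<rbrakk> \<Longrightarrow>
        h j k (x \<oplus>\<^bsub>A\<^esub> y) = h j k x \<oplus>\<^bsub>K\<^esub> h j k y"
    and smult: "\<And>j k a x. \<lbrakk>j < n; k < length (ts ! j); a \<in> carrier A; x \<in> carrier A; x \<otimes>\<^bsub>A\<^esub> e j = x;
        \<And>l. \<lbrakk>k < l; l < length (ts ! j)\<rbrakk> \<Longrightarrow> h j l x = \<zero>\<^bsub>K\<^esub>\<rbrakk> \<Longrightarrow>
        h j k (a \<otimes>\<^bsub>A\<^esub> x) = \<chi> (ts ! j ! k) a \<otimes>\<^bsub>K\<^esub> h j k x"
    and faithful: "\<And>j x. \<lbrakk>j < n; x \<in> carrier A; x \<otimes>\<^bsub>A\<^esub> e j = x;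
        \<And>k. k < length (ts ! j) \<Longrightarrow> h j k x = \<zero>\<^bsub>K\<^esub>\<rbrakk> \<Longrightarrow> x = \<zero>\<^bsub>A\<^esub>"
    and dual: "\<And>j k. \<lbrakk>j < n; k < length (ts ! j)\<rbrakk> \<Longrightarrow>
        \<exists>b\<in>carrier A. b \<otimes>\<^bsub>A\<^esub> e j = b \<and> h j k b = \<one>\<^bsub>K\<^esub> \<and>
          (\<forall>l. k < l \<and> l < length (ts ! j) \<longrightarrow> h j l b = \<zero>\<^bsub>K\<^esub>)"
  shows "cartan_matrix A (mat n n (\<lambda>(i, j). int (count_list (ts ! j) i)))"
proof (rule cartan_matrixI)
  fix i j assume ij: "i < n" "j < n"
  have P: "carrier (proj j) = {a \<in> carrier A. a \<otimes>\<^bsub>A\<^esub> e j = a}" "ring.zero (proj j) = \<zero>\<^bsub>A\<^esub>"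
    "ring.add (proj j) = ring.add A" "module.smult (proj j) = monoid.mult A"
    by (simp_all add: proj_def left_ideal_lmod_def)
  have "has_multiplicity A (proj j) (simple i) (card {k. k < length (ts ! j) \<and> ts ! j ! k = i})"
  proof (rule has_multiplicity_flag[where h = "h j" and t = "\<lambda>k. ts ! j ! k",
        OF left_module_proj[OF ij(2)] ij(1)], goal_cases)
    case (4 k a x)
    then show ?case using smult[OF ij(2), of k a x] by (simp add: P)
  next
    case (5 x)
    then show ?case using faithful[OF ij(2), of x] by (simp add: P)
  next
    case (6 k)
    then show ?case using dual[OF ij(2), of k] unfolding P by blast
  qed (use ij t closed add in \<open>simp_all add: P\<close>)
  moreover have "card {k. k < length (ts ! j) \<and> ts ! j ! k = i} = count_list (ts ! j) i"
    by (simp add: count_list_eq_length_filter length_filter_conv_card eq_commute)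
  ultimately show "\<exists>m. has_multiplicity A (proj j) (simple i) m \<and>
      mat n n (\<lambda>(i, j). int (count_list (ts ! j) i)) $$ (i, j) = int m"
    using ij by auto
qed simp

end

section \<open>Finite monoid algebras\<close>

text \<open>The inner index set depends on \<open>i\<close>, as do the factorizations inside an
  iterated convolution.\<close>

lemma (in abelian_monoid) finsum_Sigma:
  assumes "finite I" "\<And>i. i \<in> I \<Longrightarrow> finite (B i)"
    and closed: "\<And>i j. \<lbrakk>i \<in> I; j \<in> B i\<rbrakk> \<Longrightarrow> g i j \<in> carrier G"
  shows "(\<Oplus>i\<in>I. \<Oplus>j\<in>B i. g i j) = (\<Oplus>p\<in>Sigma I B. g (fst p) (snd p))"
proof -
  have "(\<Oplus>p\<in>Sigma I B. g (fst p) (snd p)) = (\<Oplus>p\<in>(\<Union>i\<in>I. Pair i ` B i). g (fst p) (snd p))"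
    by (rule arg_cong[where f = "finsum G (\<lambda>p. g (fst p) (snd p))"]) auto
  also have "\<dots> = (\<Oplus>i\<in>I. \<Oplus>p\<in>Pair i ` B i. g (fst p) (snd p))"
    using assms by (intro add.finprod_UN_disjoint) (auto simp: pairwise_def disjnt_def)
  also have "\<dots> = (\<Oplus>i\<in>I. \<Oplus>j\<in>B i. g i j)"
  proof (intro finsum_cong' refl)
    fix i assume "i \<in> I"
    with closed show "(\<Oplus>p\<in>Pair i ` B i. g (fst p) (snd p)) = (\<Oplus>j\<in>B i. g i j)"
      by (subst finsum_reindex) (auto simp: inj_on_def)
  qed (use closed in \<open>auto intro!: finsum_closed\<close>)
  finally show ?thesis by simp
qed

locale finite_monoid_algebra = K: ring K + M: monoid M
  for K :: "('k, 'r) ring_scheme" and M :: "('m, 's) monoid_scheme" +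
  assumes finite_M: "finite (carrier M)"
begin

abbreviation "A \<equiv> monoid_algebra K M"

definition factorizations :: "'m \<Rightarrow> ('m \<times> 'm) set" where
  "factorizations x = {p \<in> carrier M \<times> carrier M. fst p \<otimes>\<^bsub>M\<^esub> snd p = x}"

lemma finite_factorizations: "finite (factorizations x)"
  using finite_M by (simp add: factorizations_def)

lemma carrier_A: "f \<in> carrier A \<longleftrightarrow> f \<in> carrier M \<rightarrow>\<^sub>E carrier K"
  by (simp add: monoid_algebra_def)

lemma A_closed: "\<lbrakk>f \<in> carrier A; x \<in> carrier M\<rbrakk> \<Longrightarrow> f x \<in> carrier K"
  by (auto simp: carrier_A)

lemma A_eqI: "\<lbrakk>f \<in> carrier A; g \<in> carrier A; \<And>x. x \<in> carrier M \<Longrightarrow> f x = g x\<rbrakk> \<Longrightarrow> f = g"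
  unfolding carrier_A by (rule PiE_ext)

lemma A_mult: "x \<in> carrier M \<Longrightarrow>
    (f \<otimes>\<^bsub>A\<^esub> g) x = (\<Oplus>\<^bsub>K\<^esub>p\<in>factorizations x. f (fst p) \<otimes>\<^bsub>K\<^esub> g (snd p))"
  by (simp add: monoid_algebra_def factorizations_def)

lemma A_one: "x \<in> carrier M \<Longrightarrow> \<one>\<^bsub>A\<^esub> x = (if x = \<one>\<^bsub>M\<^esub> then \<one>\<^bsub>K\<^esub> else \<zero>\<^bsub>K\<^esub>)"
  by (simp add: monoid_algebra_def)

lemma A_zero: "x \<in> carrier M \<Longrightarrow> \<zero>\<^bsub>A\<^esub> x = \<zero>\<^bsub>K\<^esub>"
  by (simp add: monoid_algebra_def)

lemma A_add: "x \<in> carrier M \<Longrightarrow> (f \<oplus>\<^bsub>A\<^esub> g) x = f x \<oplus>\<^bsub>K\<^esub> g x"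
  by (simp add: monoid_algebra_def)

lemma A_add_closed: "\<lbrakk>f \<in> carrier A; g \<in> carrier A\<rbrakk> \<Longrightarrow> f \<oplus>\<^bsub>A\<^esub> g \<in> carrier A"
  by (auto simp: monoid_algebra_def)

lemma factorizationsD:
  "p \<in> factorizations x \<Longrightarrow> fst p \<in> carrier M" "p \<in> factorizations x \<Longrightarrow> snd p \<in> carrier M"
  "(a, b) \<in> factorizations x \<Longrightarrow> a \<in> carrier M" "(a, b) \<in> factorizations x \<Longrightarrow> b \<in> carrier M"
  by (auto simp: factorizations_def)

lemma A_mult_closed: "\<lbrakk>f \<in> carrier A; g \<in> carrier A\<rbrakk> \<Longrightarrow> f \<otimes>\<^bsub>A\<^esub> g \<in> carrier A"
  unfolding carrier_A[of "f \<otimes>\<^bsub>A\<^esub> g"]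
  by (rule PiE_I) (auto simp: A_mult A_closed factorizationsD intro!: K.finsum_closed, simp add: monoid_algebra_def)

text \<open>Both sides are sums over the ways to write \<open>x\<close> as a product
  \<open>c d b\<close> of three elements. They differ in the bracketing of the index, and
  \<open>\<psi>\<close> converts \<open>(c d) b\<close> into \<open>c (d b)\<close>.\<close>

lemma A_assoc:
  assumes f: "f \<in> carrier A" and g: "g \<in> carrier A" and h: "h \<in> carrier A"
  shows "(f \<otimes>\<^bsub>A\<^esub> g) \<otimes>\<^bsub>A\<^esub> h = f \<otimes>\<^bsub>A\<^esub> (g \<otimes>\<^bsub>A\<^esub> h)"
proof (rule A_eqI)
  note cl = A_closed[OF f] A_closed[OF g] A_closed[OF h] factorizationsD
  fix x assume x: "x \<in> carrier M"
  let ?L = "Sigma (factorizations x) (\<lambda>p. factorizations (fst p))"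
  let ?R = "Sigma (factorizations x) (\<lambda>p. factorizations (snd p))"
  define \<psi> :: "('m \<times> 'm) \<times> 'm \<times> 'm \<Rightarrow> ('m \<times> 'm) \<times> 'm \<times> 'm" where "\<psi> = (\<lambda>((a, b), (c, d)). ((c, d \<otimes>\<^bsub>M\<^esub> b), (d, b)))"
  have R: "?R = \<psi> ` ?L"
  proof (intro equalityI subsetI)
    fix r assume "r \<in> ?R"
    then obtain c y d b where r: "r = ((c, y), (d, b))" "c \<in> carrier M" "d \<in> carrier M" "b \<in> carrier M"
      "c \<otimes>\<^bsub>M\<^esub> y = x" "d \<otimes>\<^bsub>M\<^esub> b = y"
      by (auto simp: factorizations_def)
    then have "((c \<otimes>\<^bsub>M\<^esub> d, b), (c, d)) \<in> ?L"
      by (auto simp: factorizations_def M.m_assoc)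
    then show "r \<in> \<psi> ` ?L" using r by (force simp: \<psi>_def)
  qed (auto simp: \<psi>_def factorizations_def M.m_assoc)
  have inj: "inj_on \<psi> ?L"
    by (auto simp: inj_on_def \<psi>_def factorizations_def)
  have "((f \<otimes>\<^bsub>A\<^esub> g) \<otimes>\<^bsub>A\<^esub> h) x =
      (\<Oplus>\<^bsub>K\<^esub>p\<in>factorizations x. \<Oplus>\<^bsub>K\<^esub>q\<in>factorizations (fst p).
        f (fst q) \<otimes>\<^bsub>K\<^esub> g (snd q) \<otimes>\<^bsub>K\<^esub> h (snd p))"
    unfolding A_mult[OF x]
    by (intro K.finsum_cong' refl)
      (auto simp: A_mult K.finsum_ldistr finite_factorizations cl Pi_def intro!: K.finsum_closed)
  also have "\<dots> = (\<Oplus>\<^bsub>K\<^esub>w\<in>?L. f (fst (snd w)) \<otimes>\<^bsub>K\<^esub> g (snd (snd w)) \<otimes>\<^bsub>K\<^esub> h (snd (fst w)))"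
    by (rule K.finsum_Sigma) (auto simp: finite_factorizations cl)
  also have "\<dots> = (\<Oplus>\<^bsub>K\<^esub>w\<in>?L. f (fst (fst (\<psi> w))) \<otimes>\<^bsub>K\<^esub> (g (fst (snd (\<psi> w))) \<otimes>\<^bsub>K\<^esub> h (snd (snd (\<psi> w)))))"
    by (intro K.finsum_cong' refl) (auto simp: \<psi>_def K.m_assoc cl dest: factorizationsD)
  also have "\<dots> = (\<Oplus>\<^bsub>K\<^esub>w\<in>?R. f (fst (fst w)) \<otimes>\<^bsub>K\<^esub> (g (fst (snd w)) \<otimes>\<^bsub>K\<^esub> h (snd (snd w))))"
    unfolding R by (intro K.finsum_reindex[symmetric] inj) (auto simp: R[symmetric] cl)
  also have "\<dots> = (\<Oplus>\<^bsub>K\<^esub>p\<in>factorizations x. \<Oplus>\<^bsub>K\<^esub>q\<in>factorizations (snd p).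
        f (fst p) \<otimes>\<^bsub>K\<^esub> (g (fst q) \<otimes>\<^bsub>K\<^esub> h (snd q)))"
    by (rule K.finsum_Sigma[symmetric]) (auto simp: finite_factorizations cl)
  also have "\<dots> = (f \<otimes>\<^bsub>A\<^esub> (g \<otimes>\<^bsub>A\<^esub> h)) x"
    unfolding A_mult[OF x]
    by (intro K.finsum_cong' refl)
      (auto simp: A_mult K.finsum_rdistr finite_factorizations cl Pi_def intro!: K.finsum_closed)
  finally show "((f \<otimes>\<^bsub>A\<^esub> g) \<otimes>\<^bsub>A\<^esub> h) x = (f \<otimes>\<^bsub>A\<^esub> (g \<otimes>\<^bsub>A\<^esub> h)) x" .
qed (auto intro!: A_mult_closed assms)

lemma A_one_closed: "\<one>\<^bsub>A\<^esub> \<in> carrier A"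
  by (auto simp: monoid_algebra_def)

lemma A_l_one:
  assumes f: "f \<in> carrier A" shows "\<one>\<^bsub>A\<^esub> \<otimes>\<^bsub>A\<^esub> f = f"
proof (rule A_eqI)
  fix x assume x: "x \<in> carrier M"
  have "(\<one>\<^bsub>A\<^esub> \<otimes>\<^bsub>A\<^esub> f) x = (\<Oplus>\<^bsub>K\<^esub>p\<in>factorizations x. if (\<one>\<^bsub>M\<^esub>, x) = p then f (snd p) else \<zero>\<^bsub>K\<^esub>)"
    unfolding A_mult[OF x]
    by (intro K.finsum_cong' refl) (auto simp: A_one factorizations_def A_closed[OF f] split: if_splits)
  also have "\<dots> = f x"
    using x by (subst K.add.finprod_singleton)
      (auto simp: factorizations_def finite_M A_closed[OF f])
  finally show "(\<one>\<^bsub>A\<^esub> \<otimes>\<^bsub>A\<^esub> f) x = f x" .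
qed (auto intro!: A_mult_closed A_one_closed f)

lemma A_r_one:
  assumes f: "f \<in> carrier A" shows "f \<otimes>\<^bsub>A\<^esub> \<one>\<^bsub>A\<^esub> = f"
proof (rule A_eqI)
  fix x assume x: "x \<in> carrier M"
  have "(f \<otimes>\<^bsub>A\<^esub> \<one>\<^bsub>A\<^esub>) x = (\<Oplus>\<^bsub>K\<^esub>p\<in>factorizations x. if (x, \<one>\<^bsub>M\<^esub>) = p then f (fst p) else \<zero>\<^bsub>K\<^esub>)"
    unfolding A_mult[OF x]
    by (intro K.finsum_cong' refl) (auto simp: A_one factorizations_def A_closed[OF f] split: if_splits)
  also have "\<dots> = f x"
    using x by (subst K.add.finprod_singleton)
      (auto simp: factorizations_def finite_M A_closed[OF f])
  finally show "(f \<otimes>\<^bsub>A\<^esub> \<one>\<^bsub>A\<^esub>) x = f x" .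
qed (auto intro!: A_mult_closed A_one_closed f)

lemma ring_A: "ring A"
proof (rule ringI)
  show "abelian_group A"
  proof (rule abelian_groupI, goal_cases)
    case (3 f g h)
    then show ?case
      by (intro A_eqI) (auto intro!: A_add_closed simp: A_add K.a_assoc A_closed)
  next
    case (4 f g)
    then show ?case
      by (intro A_eqI) (auto intro!: A_add_closed simp: A_add K.a_comm A_closed)
  next
    case 2
    then show ?case by (auto simp: monoid_algebra_def)
  next
    case (5 f)
    then show ?case
      by (intro A_eqI) (auto intro!: A_add_closed simp: A_add A_closed A_zero, auto simp: monoid_algebra_def)
  next
    case (6 f)
    have "(\<lambda>x\<in>carrier M. \<ominus>\<^bsub>K\<^esub> f x) \<in> carrier A"
      using A_closed[OF 6] by (auto simp: carrier_A)
    moreover from this have "(\<lambda>x\<in>carrier M. \<ominus>\<^bsub>K\<^esub> f x) \<oplus>\<^bsub>A\<^esub> f = \<zero>\<^bsub>A\<^esub>"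
      by (intro A_eqI) (auto intro!: A_add_closed 6 simp: A_add A_zero K.l_neg A_closed[OF 6], auto simp: monoid_algebra_def)
    ultimately show ?case by blast
  qed (rule A_add_closed)
  show "monoid A"
    by (rule monoidI) (auto intro: A_mult_closed A_one_closed A_assoc A_l_one A_r_one)
next
  fix f g h assume "f \<in> carrier A" "g \<in> carrier A" "h \<in> carrier A"
  note cl = this this[THEN A_closed]
  show "(f \<oplus>\<^bsub>A\<^esub> g) \<otimes>\<^bsub>A\<^esub> h = f \<otimes>\<^bsub>A\<^esub> h \<oplus>\<^bsub>A\<^esub> g \<otimes>\<^bsub>A\<^esub> h"
  proof (rule A_eqI)
    fix x assume x: "x \<in> carrier M"
    have "((f \<oplus>\<^bsub>A\<^esub> g) \<otimes>\<^bsub>A\<^esub> h) x =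
        (\<Oplus>\<^bsub>K\<^esub>p\<in>factorizations x. f (fst p) \<otimes>\<^bsub>K\<^esub> h (snd p) \<oplus>\<^bsub>K\<^esub> g (fst p) \<otimes>\<^bsub>K\<^esub> h (snd p))"
      unfolding A_mult[OF x]
      by (intro K.finsum_cong' refl) (auto simp: A_add K.l_distr cl factorizationsD)
    also have "\<dots> = (f \<otimes>\<^bsub>A\<^esub> h \<oplus>\<^bsub>A\<^esub> g \<otimes>\<^bsub>A\<^esub> h) x"
      unfolding A_add[OF x] A_mult[OF x]
      by (rule K.finsum_addf) (auto simp: cl factorizationsD)
    finally show "((f \<oplus>\<^bsub>A\<^esub> g) \<otimes>\<^bsub>A\<^esub> h) x = (f \<otimes>\<^bsub>A\<^esub> h \<oplus>\<^bsub>A\<^esub> g \<otimes>\<^bsub>A\<^esub> h) x" .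
  qed (intro A_mult_closed A_add_closed cl)+
  show "h \<otimes>\<^bsub>A\<^esub> (f \<oplus>\<^bsub>A\<^esub> g) = h \<otimes>\<^bsub>A\<^esub> f \<oplus>\<^bsub>A\<^esub> h \<otimes>\<^bsub>A\<^esub> g"
  proof (rule A_eqI)
    fix x assume x: "x \<in> carrier M"
    have "(h \<otimes>\<^bsub>A\<^esub> (f \<oplus>\<^bsub>A\<^esub> g)) x =
        (\<Oplus>\<^bsub>K\<^esub>p\<in>factorizations x. h (fst p) \<otimes>\<^bsub>K\<^esub> f (snd p) \<oplus>\<^bsub>K\<^esub> h (fst p) \<otimes>\<^bsub>K\<^esub> g (snd p))"
      unfolding A_mult[OF x]
      by (intro K.finsum_cong' refl) (auto simp: A_add K.r_distr cl factorizationsD)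
    also have "\<dots> = (h \<otimes>\<^bsub>A\<^esub> f \<oplus>\<^bsub>A\<^esub> h \<otimes>\<^bsub>A\<^esub> g) x"
      unfolding A_add[OF x] A_mult[OF x]
      by (rule K.finsum_addf) (auto simp: cl factorizationsD)
    finally show "(h \<otimes>\<^bsub>A\<^esub> (f \<oplus>\<^bsub>A\<^esub> g)) x = (h \<otimes>\<^bsub>A\<^esub> f \<oplus>\<^bsub>A\<^esub> h \<otimes>\<^bsub>A\<^esub> g) x" .
  qed (intro A_mult_closed A_add_closed cl)+
qed

definition augmentation :: "('m \<Rightarrow> 'k) \<Rightarrow> 'k" where
  "augmentation f = (\<Oplus>\<^bsub>K\<^esub>x\<in>carrier M. f x)"

text \<open>Every pair of monoid elements factorizes exactly one \<open>x\<close>, so summing the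
  convolution over all \<open>x\<close> gives the sum over all pairs, which splits as a
  product.\<close>

lemma augmentation_mult:
  assumes f: "f \<in> carrier A" and g: "g \<in> carrier A"
  shows "augmentation (f \<otimes>\<^bsub>A\<^esub> g) = augmentation f \<otimes>\<^bsub>K\<^esub> augmentation g"
proof -
  note cl = A_closed[OF f] A_closed[OF g] factorizationsD
  have "augmentation (f \<otimes>\<^bsub>A\<^esub> g) =
      (\<Oplus>\<^bsub>K\<^esub>x\<in>carrier M. \<Oplus>\<^bsub>K\<^esub>p\<in>factorizations x. f (fst p) \<otimes>\<^bsub>K\<^esub> g (snd p))"
    unfolding augmentation_def
    by (intro K.finsum_cong' refl) (auto simp: A_mult cl intro!: K.finsum_closed)
  also have "\<dots> = (\<Oplus>\<^bsub>K\<^esub>p\<in>(\<Union>x\<in>carrier M. factorizations x). f (fst p) \<otimes>\<^bsub>K\<^esub> g (snd p))"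
    by (rule K.add.finprod_UN_disjoint[symmetric])
      (auto simp: finite_M finite_factorizations cl pairwise_def disjnt_def, auto simp: factorizations_def)
  also have "(\<Union>x\<in>carrier M. factorizations x) = carrier M \<times> carrier M"
    by (auto simp: factorizations_def)
  also have "(\<Oplus>\<^bsub>K\<^esub>p\<in>carrier M \<times> carrier M. f (fst p) \<otimes>\<^bsub>K\<^esub> g (snd p)) =
      (\<Oplus>\<^bsub>K\<^esub>x\<in>carrier M. \<Oplus>\<^bsub>K\<^esub>y\<in>carrier M. f x \<otimes>\<^bsub>K\<^esub> g y)"
    by (rule K.finsum_Sigma[symmetric]) (auto simp: finite_M cl)
  also have "\<dots> = (\<Oplus>\<^bsub>K\<^esub>x\<in>carrier M. f x \<otimes>\<^bsub>K\<^esub> augmentation g)"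
    unfolding augmentation_def
    by (intro K.finsum_cong' refl) (auto simp: K.finsum_rdistr finite_M cl Pi_def intro!: K.finsum_closed)
  also have "\<dots> = augmentation f \<otimes>\<^bsub>K\<^esub> augmentation g"
    unfolding augmentation_def
    by (subst K.finsum_ldistr) (auto simp: finite_M cl intro!: K.finsum_closed)
  finally show ?thesis .
qed

end

section \<open>A monoid with seven elements\<close>

text \<open>The elements \<open>0, \<dots>, 6\<close> stand for \<open>1, g, f, x\<^sub>1, x\<^sub>2, y, 0\<close>.\<close>

definition M7_mult :: "nat \<Rightarrow> nat \<Rightarrow> nat" where
  "M7_mult a b = (if a = 0 then b else if b = 0 then a
     else if a = 1 then (if b = 1 then 0 else b) else if b = 1 then a
     else if a = 2 \<and> b \<in> {2, 3, 4} then b else if a = 5 \<and> b = 2 then 5 else 6)"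

definition M7 :: "nat monoid" where
  "M7 = \<lparr>carrier = {..<7}, monoid.mult = M7_mult, one = 0\<rparr>"

lemma M7_mult_assoc: "M7_mult (M7_mult a b) c = M7_mult a (M7_mult b c)"
  by (auto simp: M7_mult_def)

lemma monoid_M7: "monoid M7"
  by (rule monoidI) (auto simp: M7_def M7_mult_assoc, auto simp: M7_mult_def)

lemma one_M7: "\<one>\<^bsub>M7\<^esub> = 0"
  by (simp add: M7_def)

lemma carrier_M7: "carrier M7 = {0, 1, 2, 3, 4, 5, 6}"
  by (auto simp: M7_def)

locale M7_algebra = K: field K for K :: "('k, 'r) ring_scheme"
begin

sublocale finite_monoid_algebra K M7
  using K.ring_axioms monoid_M7
  by (simp add: finite_monoid_algebra_def finite_monoid_algebra_axioms_def carrier_M7)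

sublocale A: ring A
  by (rule ring_A)

text \<open>As a filter of an explicit list, the set can be evaluated by rewriting.\<close>

lemma factorizations_eq_filter:
  "factorizations x = set (filter (\<lambda>p. M7_mult (fst p) (snd p) = x)
    (List.product [0, 1, 2, 3, 4, 5, 6] [0, 1, 2, 3, 4, 5, 6]))"
proof -
  have "fst p \<otimes>\<^bsub>M7\<^esub> snd p = M7_mult (fst p) (snd p)" for p
    by (simp add: M7_def)
  then show ?thesis
    unfolding factorizations_def set_filter set_product carrier_M7 by simp
qed

text \<open>The element \<open>6\<close> is left out: it is the product of 25 of the 49 pairs, and
  the augmentation replaces its coordinate throughout.\<close>

lemma factorizations_M7:
  "factorizations 0 = {(0, 0), (1, 1)}"
  "factorizations 1 = {(0, 1), (1, 0)}"
  "factorizations 2 = {(0, 2), (1, 2), (2, 0), (2, 1), (2, 2)}"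
  "factorizations 3 = {(0, 3), (1, 3), (2, 3), (3, 0), (3, 1)}"
  "factorizations 4 = {(0, 4), (1, 4), (2, 4), (4, 0), (4, 1)}"
  "factorizations 5 = {(0, 5), (1, 5), (5, 0), (5, 1), (5, 2)}"
  by (simp_all add: factorizations_eq_filter M7_mult_def)

lemma coord_closed:
  assumes "f \<in> carrier A"
  shows "f 0 \<in> carrier K" "f 1 \<in> carrier K" "f (Suc 0) \<in> carrier K" "f 2 \<in> carrier K" "f 3 \<in> carrier K"
    "f 4 \<in> carrier K" "f 5 \<in> carrier K" "f 6 \<in> carrier K"
  using A_closed[OF assms] by (simp_all add: carrier_M7)

text \<open>The elements \<open>0\<close> and \<open>1\<close> act as the identity on all others, so
  outside the unit group their coefficients enter through the sum. The coefficient at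
  \<open>2\<close> joins that sum where \<open>f\<close> acts as an identity as well, on the left
  for \<open>3\<close> and \<open>4\<close>, on the right for \<open>5\<close>.\<close>

lemma coord_mult:
  assumes "f \<in> carrier A" "g \<in> carrier A"
  shows "(f \<otimes>\<^bsub>A\<^esub> g) 0 = f 0 \<otimes>\<^bsub>K\<^esub> g 0 \<oplus>\<^bsub>K\<^esub> f 1 \<otimes>\<^bsub>K\<^esub> g 1"
    "(f \<otimes>\<^bsub>A\<^esub> g) 1 = f 0 \<otimes>\<^bsub>K\<^esub> g 1 \<oplus>\<^bsub>K\<^esub> f 1 \<otimes>\<^bsub>K\<^esub> g 0"
    "(f \<otimes>\<^bsub>A\<^esub> g) 2 = (f 0 \<oplus>\<^bsub>K\<^esub> f 1 \<oplus>\<^bsub>K\<^esub> f 2) \<otimes>\<^bsub>K\<^esub> g 2 \<oplus>\<^bsub>K\<^esub> f 2 \<otimes>\<^bsub>K\<^esub> (g 0 \<oplus>\<^bsub>K\<^esub> g 1)"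
    "(f \<otimes>\<^bsub>A\<^esub> g) 3 = (f 0 \<oplus>\<^bsub>K\<^esub> f 1 \<oplus>\<^bsub>K\<^esub> f 2) \<otimes>\<^bsub>K\<^esub> g 3 \<oplus>\<^bsub>K\<^esub> f 3 \<otimes>\<^bsub>K\<^esub> (g 0 \<oplus>\<^bsub>K\<^esub> g 1)"
    "(f \<otimes>\<^bsub>A\<^esub> g) 4 = (f 0 \<oplus>\<^bsub>K\<^esub> f 1 \<oplus>\<^bsub>K\<^esub> f 2) \<otimes>\<^bsub>K\<^esub> g 4 \<oplus>\<^bsub>K\<^esub> f 4 \<otimes>\<^bsub>K\<^esub> (g 0 \<oplus>\<^bsub>K\<^esub> g 1)"
    "(f \<otimes>\<^bsub>A\<^esub> g) 5 = (f 0 \<oplus>\<^bsub>K\<^esub> f 1) \<otimes>\<^bsub>K\<^esub> g 5 \<oplus>\<^bsub>K\<^esub> f 5 \<otimes>\<^bsub>K\<^esub> (g 0 \<oplus>\<^bsub>K\<^esub> g 1 \<oplus>\<^bsub>K\<^esub> g 2)"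
  using coord_closed[OF assms(1)] coord_closed[OF assms(2)]
  by (simp_all add: A_mult carrier_M7 factorizations_M7 factorizations_M7(2)[unfolded One_nat_def]
      K.l_distr K.r_distr K.a_ac)

lemma augmentation_coord:
  "f \<in> carrier A \<Longrightarrow> augmentation f =
    f 0 \<oplus>\<^bsub>K\<^esub> (f 1 \<oplus>\<^bsub>K\<^esub> (f 2 \<oplus>\<^bsub>K\<^esub> (f 3 \<oplus>\<^bsub>K\<^esub> (f 4 \<oplus>\<^bsub>K\<^esub> (f 5 \<oplus>\<^bsub>K\<^esub> f 6)))))"
  using coord_closed[of f] by (simp add: augmentation_def carrier_M7)

text \<open>The augmentation determines the coordinate at \<open>6\<close> from the others and,
  unlike that coordinate, is multiplicative.\<close>

lemma coord_eqI:
  assumes f: "f \<in> carrier A" and g: "g \<in> carrier A"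
    and eq: "f 0 = g 0" "f 1 = g 1" "f 2 = g 2" "f 3 = g 3" "f 4 = g 4" "f 5 = g 5"
    and aug: "augmentation f = augmentation g"
  shows "f = g"
proof (rule A_eqI[OF f g])
  have "f 6 = g 6"
    using aug coord_closed[OF f] coord_closed[OF g] eq
    by (simp add: augmentation_coord f g)
  then show "f x = g x" if "x \<in> carrier M7" for x
    using that eq by (auto simp: carrier_M7)
qed

definition coords :: "'k list \<Rightarrow> nat \<Rightarrow> 'k" where
  "coords xs = (\<lambda>i\<in>carrier M7. xs ! i)"

lemma coords_closed:
  "\<lbrakk>c0 \<in> carrier K; c1 \<in> carrier K; c2 \<in> carrier K; c3 \<in> carrier K; c4 \<in> carrier K; c5 \<in> carrier K;
    c6 \<in> carrier K\<rbrakk> \<Longrightarrow> coords [c0, c1, c2, c3, c4, c5, c6] \<in> carrier A"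
  by (auto simp: coords_def carrier_A carrier_M7)

lemma coords_coord:
  "coords [c0, c1, c2, c3, c4, c5, c6] 0 = c0" "coords [c0, c1, c2, c3, c4, c5, c6] 1 = c1"
  "coords [c0, c1, c2, c3, c4, c5, c6] (Suc 0) = c1"
  "coords [c0, c1, c2, c3, c4, c5, c6] 2 = c2" "coords [c0, c1, c2, c3, c4, c5, c6] 3 = c3"
  "coords [c0, c1, c2, c3, c4, c5, c6] 4 = c4" "coords [c0, c1, c2, c3, c4, c5, c6] 5 = c5"
  "coords [c0, c1, c2, c3, c4, c5, c6] 6 = c6"
  by (simp_all add: coords_def carrier_M7)

lemma coord_add:
  assumes "f \<in> carrier A" "g \<in> carrier A"
  shows "(f \<oplus>\<^bsub>A\<^esub> g) 0 = f 0 \<oplus>\<^bsub>K\<^esub> g 0" "(f \<oplus>\<^bsub>A\<^esub> g) 1 = f 1 \<oplus>\<^bsub>K\<^esub> g 1"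
    "(f \<oplus>\<^bsub>A\<^esub> g) 2 = f 2 \<oplus>\<^bsub>K\<^esub> g 2" "(f \<oplus>\<^bsub>A\<^esub> g) 3 = f 3 \<oplus>\<^bsub>K\<^esub> g 3"
    "(f \<oplus>\<^bsub>A\<^esub> g) 4 = f 4 \<oplus>\<^bsub>K\<^esub> g 4" "(f \<oplus>\<^bsub>A\<^esub> g) 5 = f 5 \<oplus>\<^bsub>K\<^esub> g 5"
    "augmentation (f \<oplus>\<^bsub>A\<^esub> g) = augmentation f \<oplus>\<^bsub>K\<^esub> augmentation g"
proof -
  have "(f \<oplus>\<^bsub>A\<^esub> g) 6 = f 6 \<oplus>\<^bsub>K\<^esub> g 6" by (simp add: A_add carrier_M7)
  moreover show *: "(f \<oplus>\<^bsub>A\<^esub> g) 0 = f 0 \<oplus>\<^bsub>K\<^esub> g 0" "(f \<oplus>\<^bsub>A\<^esub> g) 1 = f 1 \<oplus>\<^bsub>K\<^esub> g 1"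
    "(f \<oplus>\<^bsub>A\<^esub> g) 2 = f 2 \<oplus>\<^bsub>K\<^esub> g 2" "(f \<oplus>\<^bsub>A\<^esub> g) 3 = f 3 \<oplus>\<^bsub>K\<^esub> g 3"
    "(f \<oplus>\<^bsub>A\<^esub> g) 4 = f 4 \<oplus>\<^bsub>K\<^esub> g 4" "(f \<oplus>\<^bsub>A\<^esub> g) 5 = f 5 \<oplus>\<^bsub>K\<^esub> g 5"
    by (simp_all add: A_add carrier_M7)
  ultimately show "augmentation (f \<oplus>\<^bsub>A\<^esub> g) = augmentation f \<oplus>\<^bsub>K\<^esub> augmentation g"
    using coord_closed[OF assms(1)] coord_closed[OF assms(2)]
    by (simp add: augmentation_coord assms K.a_ac)
qed

lemma coord_zero:
  "\<zero>\<^bsub>A\<^esub> 0 = \<zero>\<^bsub>K\<^esub>" "\<zero>\<^bsub>A\<^esub> 1 = \<zero>\<^bsub>K\<^esub>" "\<zero>\<^bsub>A\<^esub> 2 = \<zero>\<^bsub>K\<^esub>" "\<zero>\<^bsub>A\<^esub> 3 = \<zero>\<^bsub>K\<^esub>" "\<zero>\<^bsub>A\<^esub> 4 = \<zero>\<^bsub>K\<^esub>" "\<zero>\<^bsub>A\<^esub> 5 = \<zero>\<^bsub>K\<^esub>"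
  "augmentation \<zero>\<^bsub>A\<^esub> = \<zero>\<^bsub>K\<^esub>"
  by (simp_all add: A_zero carrier_M7 augmentation_coord)

lemma augmentation_coords:
  "\<lbrakk>c0 \<in> carrier K; c1 \<in> carrier K; c2 \<in> carrier K; c3 \<in> carrier K; c4 \<in> carrier K; c5 \<in> carrier K;
    c6 \<in> carrier K\<rbrakk> \<Longrightarrow> augmentation (coords [c0, c1, c2, c3, c4, c5, c6]) =
    c0 \<oplus>\<^bsub>K\<^esub> (c1 \<oplus>\<^bsub>K\<^esub> (c2 \<oplus>\<^bsub>K\<^esub> (c3 \<oplus>\<^bsub>K\<^esub> (c4 \<oplus>\<^bsub>K\<^esub> (c5 \<oplus>\<^bsub>K\<^esub> c6)))))"
  by (simp add: augmentation_coord coords_closed coords_coord)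

lemma augmentation_closed: "f \<in> carrier A \<Longrightarrow> augmentation f \<in> carrier K"
  using coord_closed[of f] by (simp add: augmentation_coord)

section \<open>Characters and idempotents of the algebra\<close>

text \<open>Linear extensions of four monoid homomorphisms to \<open>K\<close>: the constant 1, the
  indicators of \<open>{1, g, f}\<close> and of \<open>{1, g}\<close>, and the sign character of
  \<open>{1, g}\<close> extended by zero. The last two agree in characteristic 2.\<close>

definition characters :: "(nat \<Rightarrow> 'k) \<Rightarrow> 'k list" where
  "characters f = [augmentation f, f 0 \<oplus>\<^bsub>K\<^esub> f 1 \<oplus>\<^bsub>K\<^esub> f 2, f 0 \<oplus>\<^bsub>K\<^esub> f 1, f 0 \<ominus>\<^bsub>K\<^esub> f 1]"

lemma less_4: "i < 4 \<longleftrightarrow> i = 0 \<or> i = 1 \<or> i = 2 \<or> i = (3::nat)"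
  by auto

lemma less_3: "i < 3 \<longleftrightarrow> i = 0 \<or> i = 1 \<or> i = (2::nat)"
  by auto

lemma characters_hom:
  assumes "i < 4" shows "(\<lambda>f. characters f ! i) \<in> Ring.ring_hom A K"
proof (rule ring_hom_memI)
  fix f g assume fg: "f \<in> carrier A" "g \<in> carrier A"
  note cl = coord_closed[OF fg(1)] coord_closed[OF fg(2)]
  show "characters f ! i \<in> carrier K"
    using assms cl augmentation_closed[OF fg(1)] by (auto simp: less_4 characters_def)
  show "characters (f \<otimes>\<^bsub>A\<^esub> g) ! i = characters f ! i \<otimes>\<^bsub>K\<^esub> characters g ! i"
    using assms cl unfolding less_4 characters_def
    by (elim disjE) (simp_all add: coord_mult[OF fg] coord_mult(2)[OF fg, simplified] augmentation_mult fg
        K.minus_eq K.l_distr K.r_distr K.l_minus K.r_minus K.minus_add K.a_ac)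
  show "characters (f \<oplus>\<^bsub>A\<^esub> g) ! i = characters f ! i \<oplus>\<^bsub>K\<^esub> characters g ! i"
    using assms cl unfolding less_4 characters_def
    by (elim disjE) (simp_all add: coord_add[OF fg] coord_add(2)[OF fg, simplified]
        K.minus_eq K.minus_add K.a_ac)
next
  show "characters \<one>\<^bsub>A\<^esub> ! i = \<one>\<^bsub>K\<^esub>"
    using assms by (auto simp: less_4 characters_def augmentation_coord A_one_closed A_one carrier_M7 one_M7 K.minus_eq)
qed

lemma characters_surj:
  assumes "i < 4" shows "(\<lambda>f. characters f ! i) ` carrier A = carrier K"
proof
  show "(\<lambda>f. characters f ! i) ` carrier A \<subseteq> carrier K"
    by (rule image_subsetI, rule ring_hom_closed[OF characters_hom[OF assms]])
  show "carrier K \<subseteq> (\<lambda>f. characters f ! i) ` carrier A"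
  proof
    fix c assume c: "c \<in> carrier K"
    \<comment> \<open>The element is \<open>c\<close> times the unit, so each character has value
      \<open>c\<close> on it.\<close>
    have "characters (coords [c, \<zero>\<^bsub>K\<^esub>, \<zero>\<^bsub>K\<^esub>, \<zero>\<^bsub>K\<^esub>, \<zero>\<^bsub>K\<^esub>, \<zero>\<^bsub>K\<^esub>, \<zero>\<^bsub>K\<^esub>]) ! i = c"
      using assms c by (auto simp: less_4 characters_def augmentation_coords coords_coord K.minus_eq)
    with c show "c \<in> (\<lambda>f. characters f ! i) ` carrier A"
      by (intro image_eqI[of _ _ "coords [c, \<zero>\<^bsub>K\<^esub>, \<zero>\<^bsub>K\<^esub>, \<zero>\<^bsub>K\<^esub>, \<zero>\<^bsub>K\<^esub>, \<zero>\<^bsub>K\<^esub>, \<zero>\<^bsub>K\<^esub>]"]) (simp_all add: coords_closed)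
  qed
qed

definition zero_idem :: "nat \<Rightarrow> 'k" where
  "zero_idem = coords [\<zero>\<^bsub>K\<^esub>, \<zero>\<^bsub>K\<^esub>, \<zero>\<^bsub>K\<^esub>, \<zero>\<^bsub>K\<^esub>, \<zero>\<^bsub>K\<^esub>, \<zero>\<^bsub>K\<^esub>, \<one>\<^bsub>K\<^esub>]"

text \<open>The difference \<open>f - 0\<close> of two monoid elements: subtracting the zero element
  makes the augmentation vanish.\<close>

definition f_idem :: "nat \<Rightarrow> 'k" where
  "f_idem = coords [\<zero>\<^bsub>K\<^esub>, \<zero>\<^bsub>K\<^esub>, \<one>\<^bsub>K\<^esub>, \<zero>\<^bsub>K\<^esub>, \<zero>\<^bsub>K\<^esub>, \<zero>\<^bsub>K\<^esub>, \<ominus>\<^bsub>K\<^esub> \<one>\<^bsub>K\<^esub>]"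

lemmas coords_simps = coords_closed coords_coord augmentation_coords coord_mult coord_mult(2)[simplified] augmentation_mult
  K.r_neg K.l_neg K.minus_eq K.l_minus K.r_minus K.minus_add

lemma zero_idem_idem: "zero_idem \<in> carrier A" "zero_idem \<otimes>\<^bsub>A\<^esub> zero_idem = zero_idem"
proof -
  show *: "zero_idem \<in> carrier A" by (simp add: zero_idem_def coords_closed)
  show "zero_idem \<otimes>\<^bsub>A\<^esub> zero_idem = zero_idem"
    by (rule coord_eqI) (use * in \<open>simp_all add: zero_idem_def coords_simps\<close>)
qed

lemma f_idem_idem: "f_idem \<in> carrier A" "f_idem \<otimes>\<^bsub>A\<^esub> f_idem = f_idem"
proof -
  show *: "f_idem \<in> carrier A" by (simp add: f_idem_def coords_closed)
  show "f_idem \<otimes>\<^bsub>A\<^esub> f_idem = f_idem"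
    by (rule coord_eqI) (use * in \<open>simp_all add: f_idem_def coords_simps\<close>)
qed

lemma zero_idem_fix:
  assumes "x \<in> carrier A" "x \<otimes>\<^bsub>A\<^esub> zero_idem = x"
  shows "x 0 = \<zero>\<^bsub>K\<^esub>" "x 1 = \<zero>\<^bsub>K\<^esub>" "x 2 = \<zero>\<^bsub>K\<^esub>" "x 3 = \<zero>\<^bsub>K\<^esub>" "x 4 = \<zero>\<^bsub>K\<^esub>" "x 5 = \<zero>\<^bsub>K\<^esub>"
  by (subst assms(2)[symmetric], simp only: coord_mult[OF assms(1) zero_idem_idem(1)],
      simp add: zero_idem_def coords_coord coord_closed[OF assms(1)])+

text \<open>What survives are the coordinates at \<open>2\<close> and \<open>5\<close>: the left
  ideal is spanned by \<open>f - 0\<close> and \<open>y - 0\<close>.\<close>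

lemma f_idem_fix:
  assumes "x \<in> carrier A" "x \<otimes>\<^bsub>A\<^esub> f_idem = x"
  shows "x 0 = \<zero>\<^bsub>K\<^esub>" "x 1 = \<zero>\<^bsub>K\<^esub>" "x 3 = \<zero>\<^bsub>K\<^esub>" "x 4 = \<zero>\<^bsub>K\<^esub>" "augmentation x = \<zero>\<^bsub>K\<^esub>"
proof -
  have "augmentation f_idem = \<zero>\<^bsub>K\<^esub>" by (simp add: f_idem_def augmentation_coords K.r_neg)
  then show "augmentation x = \<zero>\<^bsub>K\<^esub>"
    by (subst assms(2)[symmetric]) (simp add: augmentation_mult[OF assms(1) f_idem_idem(1)] augmentation_closed[OF assms(1)])
  show "x 0 = \<zero>\<^bsub>K\<^esub>" "x 1 = \<zero>\<^bsub>K\<^esub>" "x 3 = \<zero>\<^bsub>K\<^esub>" "x 4 = \<zero>\<^bsub>K\<^esub>"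
   by (subst assms(2)[symmetric], simp only: coord_mult[OF assms(1) f_idem_idem(1)],
      simp add: f_idem_def coords_coord coord_closed[OF assms(1)])+
qed


text \<open>The element \<open>p + q g - (p + q) f\<close>, a common form of
  \<open>(1 + g)/2 - f\<close>, \<open>(1 - g)/2\<close> and \<open>1 - f\<close>. The coefficient
  of \<open>f\<close> is chosen so that the first two characters vanish.\<close>

definition unit_idem :: "'k \<Rightarrow> 'k \<Rightarrow> nat \<Rightarrow> 'k" where
  "unit_idem p q = coords [p, q, \<ominus>\<^bsub>K\<^esub> (p \<oplus>\<^bsub>K\<^esub> q), \<zero>\<^bsub>K\<^esub>, \<zero>\<^bsub>K\<^esub>, \<zero>\<^bsub>K\<^esub>, \<zero>\<^bsub>K\<^esub>]"

lemma unit_idem_closed: "\<lbrakk>p \<in> carrier K; q \<in> carrier K\<rbrakk> \<Longrightarrow> unit_idem p q \<in> carrier A"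
  by (simp add: unit_idem_def coords_closed)

lemma unit_idem_coord:
  "unit_idem p q 0 = p" "unit_idem p q 1 = q" "unit_idem p q 2 = \<ominus>\<^bsub>K\<^esub> (p \<oplus>\<^bsub>K\<^esub> q)"
  "unit_idem p q 3 = \<zero>\<^bsub>K\<^esub>" "unit_idem p q 4 = \<zero>\<^bsub>K\<^esub>" "unit_idem p q 5 = \<zero>\<^bsub>K\<^esub>"
  by (simp_all only: unit_idem_def coords_coord)

lemma unit_idem_augmentation:
  "\<lbrakk>p \<in> carrier K; q \<in> carrier K\<rbrakk> \<Longrightarrow> augmentation (unit_idem p q) = \<zero>\<^bsub>K\<^esub>"
  by (simp add: unit_idem_def augmentation_coords K.a_assoc[symmetric] K.r_neg)

lemma mult_unit_idem:
  assumes p: "p \<in> carrier K" and q: "q \<in> carrier K" and x: "x \<in> carrier A"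
  shows "(x \<otimes>\<^bsub>A\<^esub> unit_idem p q) 0 = x 0 \<otimes>\<^bsub>K\<^esub> p \<oplus>\<^bsub>K\<^esub> x 1 \<otimes>\<^bsub>K\<^esub> q"
    "(x \<otimes>\<^bsub>A\<^esub> unit_idem p q) 1 = x 0 \<otimes>\<^bsub>K\<^esub> q \<oplus>\<^bsub>K\<^esub> x 1 \<otimes>\<^bsub>K\<^esub> p"
    "(x \<otimes>\<^bsub>A\<^esub> unit_idem p q) 2 = (x 0 \<oplus>\<^bsub>K\<^esub> x 1) \<otimes>\<^bsub>K\<^esub> \<ominus>\<^bsub>K\<^esub> (p \<oplus>\<^bsub>K\<^esub> q)"
    "(x \<otimes>\<^bsub>A\<^esub> unit_idem p q) 3 = x 3 \<otimes>\<^bsub>K\<^esub> (p \<oplus>\<^bsub>K\<^esub> q)"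
    "(x \<otimes>\<^bsub>A\<^esub> unit_idem p q) 4 = x 4 \<otimes>\<^bsub>K\<^esub> (p \<oplus>\<^bsub>K\<^esub> q)"
    "(x \<otimes>\<^bsub>A\<^esub> unit_idem p q) 5 = \<zero>\<^bsub>K\<^esub>"
    "augmentation (x \<otimes>\<^bsub>A\<^esub> unit_idem p q) = \<zero>\<^bsub>K\<^esub>"
proof -
  note cl = unit_idem_closed[OF p q]
  have xc: "x 0 \<in> carrier K" "x 1 \<in> carrier K" "x 2 \<in> carrier K" "x 3 \<in> carrier K" "x 4 \<in> carrier K" "x 5 \<in> carrier K"
    using coord_closed[OF x] by simp_all
  have s: "p \<oplus>\<^bsub>K\<^esub> q \<in> carrier K" using p q by simp
  show "(x \<otimes>\<^bsub>A\<^esub> unit_idem p q) 0 = x 0 \<otimes>\<^bsub>K\<^esub> p \<oplus>\<^bsub>K\<^esub> x 1 \<otimes>\<^bsub>K\<^esub> q"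
    "(x \<otimes>\<^bsub>A\<^esub> unit_idem p q) 1 = x 0 \<otimes>\<^bsub>K\<^esub> q \<oplus>\<^bsub>K\<^esub> x 1 \<otimes>\<^bsub>K\<^esub> p"
    by (simp_all only: coord_mult[OF x cl] unit_idem_coord)
  show "(x \<otimes>\<^bsub>A\<^esub> unit_idem p q) 3 = x 3 \<otimes>\<^bsub>K\<^esub> (p \<oplus>\<^bsub>K\<^esub> q)"
    "(x \<otimes>\<^bsub>A\<^esub> unit_idem p q) 4 = x 4 \<otimes>\<^bsub>K\<^esub> (p \<oplus>\<^bsub>K\<^esub> q)"
    "(x \<otimes>\<^bsub>A\<^esub> unit_idem p q) 5 = \<zero>\<^bsub>K\<^esub>"
    unfolding coord_mult[OF x cl] unit_idem_coord
    using s xc by (simp_all del: One_nat_def add: K.r_neg)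
  \<comment> \<open>The coefficient \<open>x 2\<close> cancels, since \<open>f\<close> times
    \<open>unit_idem p q\<close> is zero.\<close>
  have "(u \<oplus>\<^bsub>K\<^esub> v) \<otimes>\<^bsub>K\<^esub> \<ominus>\<^bsub>K\<^esub> s \<oplus>\<^bsub>K\<^esub> v \<otimes>\<^bsub>K\<^esub> s = u \<otimes>\<^bsub>K\<^esub> \<ominus>\<^bsub>K\<^esub> s"
    if "u \<in> carrier K" "v \<in> carrier K" "s \<in> carrier K" for u v s
  proof -
    have "(u \<oplus>\<^bsub>K\<^esub> v) \<otimes>\<^bsub>K\<^esub> \<ominus>\<^bsub>K\<^esub> s \<oplus>\<^bsub>K\<^esub> v \<otimes>\<^bsub>K\<^esub> s = u \<otimes>\<^bsub>K\<^esub> \<ominus>\<^bsub>K\<^esub> s \<oplus>\<^bsub>K\<^esub> v \<otimes>\<^bsub>K\<^esub> (\<ominus>\<^bsub>K\<^esub> s \<oplus>\<^bsub>K\<^esub> s)"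
      using that by (simp only: K.l_distr K.r_distr K.a_assoc K.a_closed K.a_inv_closed K.m_closed)
    then show ?thesis using that by (simp add: K.l_neg)
  qed
  from this[of "x 0 \<oplus>\<^bsub>K\<^esub> x 1" "x 2" "p \<oplus>\<^bsub>K\<^esub> q"]
  show "(x \<otimes>\<^bsub>A\<^esub> unit_idem p q) 2 = (x 0 \<oplus>\<^bsub>K\<^esub> x 1) \<otimes>\<^bsub>K\<^esub> \<ominus>\<^bsub>K\<^esub> (p \<oplus>\<^bsub>K\<^esub> q)"
    unfolding coord_mult[OF x cl] unit_idem_coord
    using s xc by simp
  show "augmentation (x \<otimes>\<^bsub>A\<^esub> unit_idem p q) = \<zero>\<^bsub>K\<^esub>"
    using x by (simp add: augmentation_mult cl unit_idem_augmentation p q augmentation_closed)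
qed

text \<open>The hypotheses say that \<open>p + q g\<close> is idempotent in the group algebra of
  \<open>{1, g}\<close>. Their sum is \<open>(p + q) (p + q) = p + q\<close>, which settles the
  coefficient of \<open>f\<close>.\<close>

lemma unit_idem_idem:
  assumes p: "p \<in> carrier K" and q: "q \<in> carrier K"
    and "p \<otimes>\<^bsub>K\<^esub> p \<oplus>\<^bsub>K\<^esub> q \<otimes>\<^bsub>K\<^esub> q = p" "p \<otimes>\<^bsub>K\<^esub> q \<oplus>\<^bsub>K\<^esub> q \<otimes>\<^bsub>K\<^esub> p = q"
  shows "unit_idem p q \<otimes>\<^bsub>A\<^esub> unit_idem p q = unit_idem p q"
proof (rule coord_eqI)
  have "(p \<oplus>\<^bsub>K\<^esub> q) \<otimes>\<^bsub>K\<^esub> (p \<oplus>\<^bsub>K\<^esub> q)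
      = (p \<otimes>\<^bsub>K\<^esub> p \<oplus>\<^bsub>K\<^esub> q \<otimes>\<^bsub>K\<^esub> q) \<oplus>\<^bsub>K\<^esub> (p \<otimes>\<^bsub>K\<^esub> q \<oplus>\<^bsub>K\<^esub> q \<otimes>\<^bsub>K\<^esub> p)"
    using p q by (simp add: K.l_distr K.r_distr K.a_ac)
  then have "(p \<oplus>\<^bsub>K\<^esub> q) \<otimes>\<^bsub>K\<^esub> (p \<oplus>\<^bsub>K\<^esub> q) = p \<oplus>\<^bsub>K\<^esub> q"
    by (simp only: assms(3,4))
  then show "(unit_idem p q \<otimes>\<^bsub>A\<^esub> unit_idem p q) 2 = unit_idem p q 2"
    using p q by (simp only: mult_unit_idem(3)[OF p q unit_idem_closed[OF p q]] unit_idem_coord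
      K.r_minus K.a_closed)
qed (use assms in \<open>simp_all only: mult_unit_idem[OF p q unit_idem_closed[OF p q]]
    unit_idem_coord unit_idem_closed A.m_closed unit_idem_augmentation K.l_null K.a_closed\<close>)

lemma unit_idem_fix:
  assumes p: "p \<in> carrier K" and q: "q \<in> carrier K" and x: "x \<in> carrier A"
    and fixed: "x \<otimes>\<^bsub>A\<^esub> unit_idem p q = x"
  shows "x 0 = x 0 \<otimes>\<^bsub>K\<^esub> p \<oplus>\<^bsub>K\<^esub> x 1 \<otimes>\<^bsub>K\<^esub> q" "x 1 = x 0 \<otimes>\<^bsub>K\<^esub> q \<oplus>\<^bsub>K\<^esub> x 1 \<otimes>\<^bsub>K\<^esub> p"
    "x 2 = (x 0 \<oplus>\<^bsub>K\<^esub> x 1) \<otimes>\<^bsub>K\<^esub> \<ominus>\<^bsub>K\<^esub> (p \<oplus>\<^bsub>K\<^esub> q)"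
    "x 3 = x 3 \<otimes>\<^bsub>K\<^esub> (p \<oplus>\<^bsub>K\<^esub> q)" "x 4 = x 4 \<otimes>\<^bsub>K\<^esub> (p \<oplus>\<^bsub>K\<^esub> q)"
    "x 5 = \<zero>\<^bsub>K\<^esub>" "augmentation x = \<zero>\<^bsub>K\<^esub>"
  by (rule mult_unit_idem[OF p q x, unfolded fixed])+

lemma characters_zero_idem: "characters zero_idem = [\<one>\<^bsub>K\<^esub>, \<zero>\<^bsub>K\<^esub>, \<zero>\<^bsub>K\<^esub>, \<zero>\<^bsub>K\<^esub>]"
  by (simp add: characters_def zero_idem_def augmentation_coords coords_coord K.minus_eq)

lemma characters_f_idem: "characters f_idem = [\<zero>\<^bsub>K\<^esub>, \<one>\<^bsub>K\<^esub>, \<zero>\<^bsub>K\<^esub>, \<zero>\<^bsub>K\<^esub>]"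
  by (simp add: characters_def f_idem_def augmentation_coords coords_coord K.minus_eq K.r_neg)

lemma characters_unit_idem:
  assumes "p \<in> carrier K" "q \<in> carrier K"
  shows "characters (unit_idem p q) = [\<zero>\<^bsub>K\<^esub>, \<zero>\<^bsub>K\<^esub>, p \<oplus>\<^bsub>K\<^esub> q, p \<ominus>\<^bsub>K\<^esub> q]"
  using assms unfolding characters_def unit_idem_coord
  by (simp add: unit_idem_augmentation K.r_neg)

text \<open>The first three characters make all coordinates of the product vanish except those at
  \<open>1\<close> and \<open>g\<close>. These two are left as hypotheses because the reason depends
  on the characteristic: either \<open>a 0\<close> and \<open>a 1\<close> are zero, or two equal
  terms cancel.\<close>

lemma radical_square_zero_coord:
  assumes a: "a \<in> carrier A" and b: "b \<in> carrier A"
    and "\<And>i. i < 3 \<Longrightarrow> characters a ! i = \<zero>\<^bsub>K\<^esub>" "\<And>i. i < 3 \<Longrightarrow> characters b ! i = \<zero>\<^bsub>K\<^esub>"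
    and "a 0 \<otimes>\<^bsub>K\<^esub> b 0 \<oplus>\<^bsub>K\<^esub> a 1 \<otimes>\<^bsub>K\<^esub> b 1 = \<zero>\<^bsub>K\<^esub>" "a 0 \<otimes>\<^bsub>K\<^esub> b 1 \<oplus>\<^bsub>K\<^esub> a 1 \<otimes>\<^bsub>K\<^esub> b 0 = \<zero>\<^bsub>K\<^esub>"
  shows "a \<otimes>\<^bsub>A\<^esub> b = \<zero>\<^bsub>A\<^esub>"
proof -
  have ac: "a 0 \<in> carrier K" "a 1 \<in> carrier K" "a 2 \<in> carrier K" "a 3 \<in> carrier K" "a 4 \<in> carrier K" "a 5 \<in> carrier K"
    using coord_closed[OF a] by simp_all
  have bc: "b 0 \<in> carrier K" "b 1 \<in> carrier K" "b 2 \<in> carrier K" "b 3 \<in> carrier K" "b 4 \<in> carrier K" "b 5 \<in> carrier K"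
    using coord_closed[OF b] by simp_all
  have a0: "augmentation a = \<zero>\<^bsub>K\<^esub>" "a 0 \<oplus>\<^bsub>K\<^esub> a 1 \<oplus>\<^bsub>K\<^esub> a 2 = \<zero>\<^bsub>K\<^esub>" "a 0 \<oplus>\<^bsub>K\<^esub> a 1 = \<zero>\<^bsub>K\<^esub>"
    using assms(3)[of 0] assms(3)[of 1] assms(3)[of 2] by (simp_all add: characters_def)
  then have a2: "a 2 = \<zero>\<^bsub>K\<^esub>" using ac by simp
  have b0: "augmentation b = \<zero>\<^bsub>K\<^esub>" "b 0 \<oplus>\<^bsub>K\<^esub> b 1 \<oplus>\<^bsub>K\<^esub> b 2 = \<zero>\<^bsub>K\<^esub>" "b 0 \<oplus>\<^bsub>K\<^esub> b 1 = \<zero>\<^bsub>K\<^esub>"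
    using assms(4)[of 0] assms(4)[of 1] assms(4)[of 2] by (simp_all add: characters_def)
  then have b2: "b 2 = \<zero>\<^bsub>K\<^esub>" using bc by simp
  show ?thesis
    by (rule coord_eqI)
      (use a b assms(5,6) a0(1) b0(1) a2 b2 ac bc in
        \<open>simp_all only: coord_mult[OF a b] coord_zero augmentation_mult a0(3) b0(3) K.r_null K.l_null
          K.r_zero K.zero_closed A.m_closed A.zero_closed\<close>)
qed

lemma characters_nth:
  "characters f ! 0 = augmentation f" "characters f ! 1 = f 0 \<oplus>\<^bsub>K\<^esub> f 1 \<oplus>\<^bsub>K\<^esub> f 2"
  "characters f ! 2 = f 0 \<oplus>\<^bsub>K\<^esub> f 1" "characters f ! 3 = f 0 \<ominus>\<^bsub>K\<^esub> f 1"
  by (simp_all add: characters_def)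

text \<open>The triangular rules that \<open>cartan_matrix_flags\<close> asks for. Each side
  condition either holds on the left ideal in question or says that a later functional of the flag
  vanishes.\<close>

lemma coord_mult_fixed:
  assumes a: "a \<in> carrier A" and x: "x \<in> carrier A"
  shows "augmentation (a \<otimes>\<^bsub>A\<^esub> x) = characters a ! 0 \<otimes>\<^bsub>K\<^esub> augmentation x"
    and "(a \<otimes>\<^bsub>A\<^esub> x) 0 \<oplus>\<^bsub>K\<^esub> (a \<otimes>\<^bsub>A\<^esub> x) 1 = characters a ! 2 \<otimes>\<^bsub>K\<^esub> (x 0 \<oplus>\<^bsub>K\<^esub> x 1)"
    and "(a \<otimes>\<^bsub>A\<^esub> x) 0 \<ominus>\<^bsub>K\<^esub> (a \<otimes>\<^bsub>A\<^esub> x) 1 = characters a ! 3 \<otimes>\<^bsub>K\<^esub> (x 0 \<ominus>\<^bsub>K\<^esub> x 1)"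
    and "x 0 \<oplus>\<^bsub>K\<^esub> x 1 = \<zero>\<^bsub>K\<^esub> \<Longrightarrow> (a \<otimes>\<^bsub>A\<^esub> x) 2 = characters a ! 1 \<otimes>\<^bsub>K\<^esub> x 2"
    and "x 0 \<oplus>\<^bsub>K\<^esub> x 1 = \<zero>\<^bsub>K\<^esub> \<Longrightarrow> (a \<otimes>\<^bsub>A\<^esub> x) 3 = characters a ! 1 \<otimes>\<^bsub>K\<^esub> x 3"
    and "x 0 \<oplus>\<^bsub>K\<^esub> x 1 = \<zero>\<^bsub>K\<^esub> \<Longrightarrow> (a \<otimes>\<^bsub>A\<^esub> x) 4 = characters a ! 1 \<otimes>\<^bsub>K\<^esub> x 4"
    and "x 0 \<oplus>\<^bsub>K\<^esub> x 1 = \<zero>\<^bsub>K\<^esub> \<Longrightarrow> x 2 = \<zero>\<^bsub>K\<^esub> \<Longrightarrow> (a \<otimes>\<^bsub>A\<^esub> x) 5 = characters a ! 2 \<otimes>\<^bsub>K\<^esub> x 5"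
proof -
  have ac: "a 0 \<in> carrier K" "a 1 \<in> carrier K" "a 2 \<in> carrier K" "a 3 \<in> carrier K" "a 4 \<in> carrier K" "a 5 \<in> carrier K"
    using coord_closed[OF a] by simp_all
  have xc: "x 0 \<in> carrier K" "x 1 \<in> carrier K" "x 2 \<in> carrier K" "x 3 \<in> carrier K" "x 4 \<in> carrier K" "x 5 \<in> carrier K"
    using coord_closed[OF x] by simp_all
  show "augmentation (a \<otimes>\<^bsub>A\<^esub> x) = characters a ! 0 \<otimes>\<^bsub>K\<^esub> augmentation x"
    using a x by (simp add: augmentation_mult characters_nth)
  show "(a \<otimes>\<^bsub>A\<^esub> x) 0 \<oplus>\<^bsub>K\<^esub> (a \<otimes>\<^bsub>A\<^esub> x) 1 = characters a ! 2 \<otimes>\<^bsub>K\<^esub> (x 0 \<oplus>\<^bsub>K\<^esub> x 1)"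
    using ring_hom_mult[OF characters_hom[of 2] a x] unfolding characters_nth by simp
  show "(a \<otimes>\<^bsub>A\<^esub> x) 0 \<ominus>\<^bsub>K\<^esub> (a \<otimes>\<^bsub>A\<^esub> x) 1 = characters a ! 3 \<otimes>\<^bsub>K\<^esub> (x 0 \<ominus>\<^bsub>K\<^esub> x 1)"
    using ring_hom_mult[OF characters_hom[of 3] a x] unfolding characters_nth by simp
  show "(a \<otimes>\<^bsub>A\<^esub> x) 2 = characters a ! 1 \<otimes>\<^bsub>K\<^esub> x 2" "(a \<otimes>\<^bsub>A\<^esub> x) 3 = characters a ! 1 \<otimes>\<^bsub>K\<^esub> x 3"
    "(a \<otimes>\<^bsub>A\<^esub> x) 4 = characters a ! 1 \<otimes>\<^bsub>K\<^esub> x 4" if "x 0 \<oplus>\<^bsub>K\<^esub> x 1 = \<zero>\<^bsub>K\<^esub>"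
    unfolding coord_mult[OF a x] characters_nth that using ac xc by (simp_all del: One_nat_def)
  show "(a \<otimes>\<^bsub>A\<^esub> x) 5 = characters a ! 2 \<otimes>\<^bsub>K\<^esub> x 5" if "x 0 \<oplus>\<^bsub>K\<^esub> x 1 = \<zero>\<^bsub>K\<^esub>" "x 2 = \<zero>\<^bsub>K\<^esub>"
    unfolding coord_mult[OF a x] characters_nth that using ac xc by (simp_all del: One_nat_def)
qed

text \<open>The vector \<open>y - 0\<close>, dual to the coordinate at \<open>5\<close>, spans the
  radical part of \<open>A (f - 0)\<close>.\<close>

lemma f_idem_fix_y:
  fixes y defines "y \<equiv> coords [\<zero>\<^bsub>K\<^esub>, \<zero>\<^bsub>K\<^esub>, \<zero>\<^bsub>K\<^esub>, \<zero>\<^bsub>K\<^esub>, \<zero>\<^bsub>K\<^esub>, \<one>\<^bsub>K\<^esub>, \<ominus>\<^bsub>K\<^esub> \<one>\<^bsub>K\<^esub>]"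
  shows "y \<in> carrier A" "y \<otimes>\<^bsub>A\<^esub> f_idem = y" "y 5 = \<one>\<^bsub>K\<^esub>" "y 2 = \<zero>\<^bsub>K\<^esub>"
proof -
  show y: "y \<in> carrier A" by (simp add: y_def coords_closed)
  show "y \<otimes>\<^bsub>A\<^esub> f_idem = y"
    by (rule coord_eqI) (use y f_idem_idem in \<open>simp_all add: y_def f_idem_def coords_simps\<close>)
qed (simp_all add: y_def coords_coord)

text \<open>With \<open>(c, d)\<close> equal to \<open>(1, 0)\<close> and \<open>(0, 1)\<close>
  these are the vectors dual to the coordinates at \<open>3\<close> and \<open>4\<close>. Right
  multiplication by \<open>unit_idem p q\<close> scales them by \<open>p + q\<close>.\<close>

lemma unit_idem_fix_x:
  fixes c d assumes c: "c \<in> carrier K" and d: "d \<in> carrier K"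
    and p: "p \<in> carrier K" and q: "q \<in> carrier K" and pq: "p \<oplus>\<^bsub>K\<^esub> q = \<one>\<^bsub>K\<^esub>"
  defines "x \<equiv> coords [\<zero>\<^bsub>K\<^esub>, \<zero>\<^bsub>K\<^esub>, \<zero>\<^bsub>K\<^esub>, c, d, \<zero>\<^bsub>K\<^esub>, \<ominus>\<^bsub>K\<^esub> (c \<oplus>\<^bsub>K\<^esub> d)]"
  shows "x \<in> carrier A" "x \<otimes>\<^bsub>A\<^esub> unit_idem p q = x" "x 0 = \<zero>\<^bsub>K\<^esub>" "x 1 = \<zero>\<^bsub>K\<^esub>" "x 3 = c" "x 4 = d"
proof -
  show x: "x \<in> carrier A" using c d by (simp add: x_def coords_closed)
  show x0: "x 0 = \<zero>\<^bsub>K\<^esub>" and x1: "x 1 = \<zero>\<^bsub>K\<^esub>" and x3: "x 3 = c" and x4: "x 4 = d"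
    by (simp_all add: x_def coords_coord)
  have x25: "x 2 = \<zero>\<^bsub>K\<^esub>" "x 5 = \<zero>\<^bsub>K\<^esub>" "augmentation x = \<zero>\<^bsub>K\<^esub>"
    using c d by (simp_all add: x_def coords_coord augmentation_coords K.a_assoc[symmetric] K.r_neg)
  show "x \<otimes>\<^bsub>A\<^esub> unit_idem p q = x"
  proof (rule coord_eqI)
    show "x \<otimes>\<^bsub>A\<^esub> unit_idem p q \<in> carrier A" using x p q by (simp add: unit_idem_closed)
  qed (use x c d p q in \<open>simp_all only: mult_unit_idem x0 x1 x3 x4 x25 pq K.l_null K.r_one K.r_zero
      K.zero_closed K.a_inv_closed K.one_closed\<close>)
qed

section \<open>The Cartan matrix when 2 is invertible\<close>

text \<open>One half \<open>h\<close> separates the trivial and the sign character of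
  \<open>{1, g}\<close>. In the factor lists, the \<open>2\<close> below the \<open>1\<close> comes
  from \<open>y\<close>, and the two \<open>1\<close> below the \<open>2\<close> come from
  \<open>x\<^sub>1\<close> and \<open>x\<^sub>2\<close>.\<close>

lemma cartan_matrix_half:
  assumes h: "h \<in> carrier K" and hh: "h \<oplus>\<^bsub>K\<^esub> h = \<one>\<^bsub>K\<^esub>"
  shows "cartan_matrix A (mat 4 4 (\<lambda>(i, j). int (count_list ([[0], [2, 1], [1, 1, 2], [3]] ! j) i)))"
proof -
  have sq: "h \<otimes>\<^bsub>K\<^esub> h \<oplus>\<^bsub>K\<^esub> h \<otimes>\<^bsub>K\<^esub> h = h"
    using h by (simp add: K.r_distr[symmetric] hh)
  \<comment> \<open>In the order of the characters dual to them; the last two are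
    \<open>(1 + g)/2 - f\<close> and \<open>(1 - g)/2\<close>.\<close>
  define E where "E = [zero_idem, f_idem, unit_idem h h, unit_idem h (\<ominus>\<^bsub>K\<^esub> h)]"
  have nh: "\<ominus>\<^bsub>K\<^esub> h \<in> carrier K" using h by simp
  have hx: "h \<otimes>\<^bsub>K\<^esub> x \<oplus>\<^bsub>K\<^esub> h \<otimes>\<^bsub>K\<^esub> x = x" if "x \<in> carrier K" for x
    using h that by (simp add: K.l_distr[symmetric] hh)
  have eq0: "x = \<zero>\<^bsub>K\<^esub> \<and> y = \<zero>\<^bsub>K\<^esub>"
    if xy: "x \<in> carrier K" "y \<in> carrier K" "x \<oplus>\<^bsub>K\<^esub> y = \<zero>\<^bsub>K\<^esub>" "x \<ominus>\<^bsub>K\<^esub> y = \<zero>\<^bsub>K\<^esub>" for x y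
  proof -
    have "x = h \<otimes>\<^bsub>K\<^esub> (x \<oplus>\<^bsub>K\<^esub> x)" using hx[OF xy(1)] h xy(1) by (simp add: K.r_distr)
    also have "x \<oplus>\<^bsub>K\<^esub> x = (x \<oplus>\<^bsub>K\<^esub> y) \<oplus>\<^bsub>K\<^esub> (x \<ominus>\<^bsub>K\<^esub> y)"
      using xy(1,2) by (simp add: K.minus_eq K.a_ac K.r_neg K.r_neg2)
    finally have "x = \<zero>\<^bsub>K\<^esub>" unfolding xy(3,4) using h by simp
    with xy(2,3) show ?thesis by simp
  qed
  interpret R: radical_square_zero_ring A K 4 "\<lambda>i f. characters f ! i" "\<lambda>j. E ! j"
  proof (unfold_locales, goal_cases)
    case (3 i)
    then show ?case using h nh by (auto simp: less_4 E_def zero_idem_idem f_idem_idem unit_idem_closed)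
  next
    case (4 i)
    have "unit_idem h h \<otimes>\<^bsub>A\<^esub> unit_idem h h = unit_idem h h"
      by (rule unit_idem_idem[OF h h]) (simp_all add: sq)
    moreover have "unit_idem h (\<ominus>\<^bsub>K\<^esub> h) \<otimes>\<^bsub>A\<^esub> unit_idem h (\<ominus>\<^bsub>K\<^esub> h) = unit_idem h (\<ominus>\<^bsub>K\<^esub> h)"
      using h by (intro unit_idem_idem[OF h nh]) (simp_all add: sq K.l_minus K.r_minus K.minus_add[symmetric])
    ultimately show ?case using 4 by (auto simp: less_4 E_def zero_idem_idem f_idem_idem)
  next
    case (5 i j)
    then show ?case
      using h nh hh
      by (auto simp: less_4 E_def characters_zero_idem characters_f_idem characters_unit_idem K.minus_eq K.r_neg)
  next
    case (6 a b)
    note ab = 6(1,2)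
    \<comment> \<open>The characters \<open>2\<close> and \<open>3\<close> give the sum and the
      difference of \<open>a 0\<close> and \<open>a 1\<close>.\<close>
    have "a 0 = \<zero>\<^bsub>K\<^esub> \<and> a 1 = \<zero>\<^bsub>K\<^esub>"
      using 6(3)[of 2] 6(3)[of 3] coord_closed[OF ab(1)] by (intro eq0) (simp_all add: characters_def)
    then show ?case
      using 6 coord_closed[OF ab(1)] coord_closed[OF ab(2)] by (intro radical_square_zero_coord) simp_all
  qed (use characters_hom characters_surj in auto)
  have idx: "j = 0 \<and> k = 0 \<or> j = 1 \<and> k = 0 \<or> j = 1 \<and> k = 1 \<or> j = 2 \<and> k = 0 \<or> j = 2 \<and> k = 1 \<or>
      j = 2 \<and> k = 2 \<or> j = 3 \<and> k = 0"
    if "j < 4" "k < length ([[0], [2, 1], [1, 1, 2], [3]] ! j :: nat list)" for j k :: nat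
    using that by (auto simp: less_4 less_Suc_eq)
  show ?thesis
  \<comment> \<open>Coordinates on each \<open>A e j\<close> in the order of the factor list: the
    last one detects the head, those before it the radical elements.\<close>
  proof (rule R.cartan_matrix_flags[where
        h = "\<lambda>j k x. [[augmentation x], [x 5, x 2], [x 3, x 4, x 0 \<oplus>\<^bsub>K\<^esub> x 1], [x 0 \<ominus>\<^bsub>K\<^esub> x 1]] ! j ! k"], goal_cases)
    case (1 j k)
    then show ?case by (auto dest!: idx)
  next
    case (2 j k x)
    then show ?case
      using augmentation_closed[OF 2(3)] coord_closed[OF 2(3)] by (auto dest!: idx)
  next
    case (3 j k x y)
    from idx[OF 3(1,2)] show ?case
      using coord_add[OF 3(3,4)] coord_add(2)[OF 3(3,4), simplified] coord_closed[OF 3(3)] coord_closed[OF 3(4)]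
      by (elim disjE) (simp_all add: K.minus_eq K.minus_add K.a_ac)
  next
    case (4 j k a x)
    note m = coord_mult_fixed[OF 4(3,4)]
    note v = 4(6)[of 1] 4(6)[of 2]
    from idx[OF 4(1,2)] show ?case
    proof (elim disjE conjE, goal_cases)
      case 1
      then show ?case using m(1) by simp
    next
      case 2
      then have "x \<otimes>\<^bsub>A\<^esub> f_idem = x" "x 2 = \<zero>\<^bsub>K\<^esub>" using 4(5) v by (simp_all add: E_def)
      with 2 show ?case using m(7) f_idem_fix[OF 4(4)] by simp
    next
      case 3
      then have "x \<otimes>\<^bsub>A\<^esub> f_idem = x" using 4(5) by (simp add: E_def)
      with 3 show ?case using m(4) f_idem_fix[OF 4(4)] by simp
    next
      case 4
      then show ?case using m(5) v by simp
    next
      case 5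
      then show ?case using m(6) v by simp
    next
      case 6
      then show ?case using m(2) by simp
    next
      case 7
      then show ?case using m(3) by simp
    qed
  next
    case (5 j x)
    note xc = coord_closed[OF 5(2)]
    note v = 5(4)[of 0] 5(4)[of 1] 5(4)[of 2]
    from 5(1)[unfolded less_4] show ?case
    proof (elim disjE, goal_cases)
      case 1
      then show ?case
        using zero_idem_fix[OF 5(2)] 5(3) v by (intro coord_eqI 5) (simp_all add: E_def coord_zero coord_zero(2)[simplified])
    next
      case 2
      then show ?case
        using f_idem_fix[OF 5(2)] 5(3) v by (intro coord_eqI 5) (simp_all add: E_def coord_zero coord_zero(2)[simplified])
    next
      case 3
      then have f: "x \<otimes>\<^bsub>A\<^esub> unit_idem h h = x" and x: "x 3 = \<zero>\<^bsub>K\<^esub>" "x 4 = \<zero>\<^bsub>K\<^esub>" "x 0 \<oplus>\<^bsub>K\<^esub> x 1 = \<zero>\<^bsub>K\<^esub>"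
        using 5(3) v by (simp_all add: E_def)
      note u = unit_idem_fix[OF h h 5(2) f]
      have "x 0 \<otimes>\<^bsub>K\<^esub> h \<oplus>\<^bsub>K\<^esub> x 1 \<otimes>\<^bsub>K\<^esub> h = (x 0 \<oplus>\<^bsub>K\<^esub> x 1) \<otimes>\<^bsub>K\<^esub> h"
        using xc h by (simp add: K.l_distr)
      then have z: "x 0 \<otimes>\<^bsub>K\<^esub> h \<oplus>\<^bsub>K\<^esub> x 1 \<otimes>\<^bsub>K\<^esub> h = \<zero>\<^bsub>K\<^esub>" using x h by simp
      have "x 2 = \<zero>\<^bsub>K\<^esub>" using u(3) h unfolding x by simp
      with u(1,2)[unfolded z] u(6,7) x show ?case
        by (intro coord_eqI 5) (simp_all only: coord_zero A.zero_closed)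
    next
      case 4
      then have f: "x \<otimes>\<^bsub>A\<^esub> unit_idem h (\<ominus>\<^bsub>K\<^esub> h) = x" and x: "x 0 \<ominus>\<^bsub>K\<^esub> x 1 = \<zero>\<^bsub>K\<^esub>"
        using 5(3) v by (simp_all add: E_def)
      note u = unit_idem_fix[OF h nh 5(2) f]
      have eq: "x 1 = x 0" using x xc by simp
      \<comment> \<open>With \<open>x 1 = x 0\<close> the fixed-point equation reads
        \<open>x 0 = x 0 h - x 0 h\<close>.\<close>
      have z: "x 0 = \<zero>\<^bsub>K\<^esub>" using u(1) xc h unfolding eq by (simp add: K.r_minus K.r_neg)
      have "h \<oplus>\<^bsub>K\<^esub> \<ominus>\<^bsub>K\<^esub> h = \<zero>\<^bsub>K\<^esub>" using h by (rule K.r_neg)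
      then have "x 3 = \<zero>\<^bsub>K\<^esub>" "x 4 = \<zero>\<^bsub>K\<^esub>" "x 2 = \<zero>\<^bsub>K\<^esub>"
        using u(3,4,5) xc by simp_all
      with z eq u(6,7) show ?case
        by (intro coord_eqI 5) (simp_all only: coord_zero A.zero_closed)
    qed
  next
    case (6 j k)
    from idx[OF 6(1,2)] show ?case
    proof (elim disjE conjE, goal_cases)
      case 1
      then show ?case
        by (intro bexI[of _ zero_idem]) (simp_all add: E_def zero_idem_idem, simp add: zero_idem_def augmentation_coords)
    next
      case 2
      then show ?case
        using f_idem_fix_y by (intro bexI[of _ "coords [\<zero>\<^bsub>K\<^esub>, \<zero>\<^bsub>K\<^esub>, \<zero>\<^bsub>K\<^esub>, \<zero>\<^bsub>K\<^esub>, \<zero>\<^bsub>K\<^esub>, \<one>\<^bsub>K\<^esub>, \<ominus>\<^bsub>K\<^esub> \<one>\<^bsub>K\<^esub>]"])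
          (auto simp: E_def less_Suc_eq)
    next
      case 3
      then show ?case
        by (intro bexI[of _ f_idem]) (simp_all add: E_def f_idem_idem, simp add: f_idem_def coords_coord)
    next
      case 4
      then show ?case
        using unit_idem_fix_x[OF K.one_closed K.zero_closed h h hh]
        by (intro bexI) (auto simp: E_def less_Suc_eq)
    next
      case 5
      then show ?case
        using unit_idem_fix_x[OF K.zero_closed K.one_closed h h hh]
        by (intro bexI) (auto simp: E_def less_Suc_eq)
    next
      case 6
      then show ?case
        using unit_idem_closed[OF h h] unit_idem_idem[OF h h] sq unit_idem_coord[of h h] hh
        by (intro bexI[of _ "unit_idem h h"]) (simp_all add: E_def)
    next
      case 7
      then show ?case
        using R.e_closed[of 3] R.e_idem[of 3] unit_idem_coord[of h "\<ominus>\<^bsub>K\<^esub> h"] hh h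
        by (intro bexI[of _ "unit_idem h (\<ominus>\<^bsub>K\<^esub> h)"]) (auto simp: E_def K.minus_eq)
    qed
  qed
qed

section \<open>The Cartan matrix in characteristic two\<close>

text \<open>The character \<open>3\<close> now equals the character \<open>2\<close>, which leaves
  three simple modules. The first \<open>2\<close> in the last factor list comes from
  \<open>1 - g\<close>, which has become radical.\<close>

lemma cartan_matrix_char_two:
  assumes two: "\<one>\<^bsub>K\<^esub> \<oplus>\<^bsub>K\<^esub> \<one>\<^bsub>K\<^esub> = \<zero>\<^bsub>K\<^esub>"
  shows "cartan_matrix A (mat 3 3 (\<lambda>(i, j). int (count_list ([[0], [2, 1], [1, 1, 2, 2]] ! j) i)))"
proof -
  define E where "E = [zero_idem, f_idem, unit_idem \<one>\<^bsub>K\<^esub> \<zero>\<^bsub>K\<^esub>]"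
  have dbl: "x \<oplus>\<^bsub>K\<^esub> x = \<zero>\<^bsub>K\<^esub>" if "x \<in> carrier K" for x
    using K.r_distr[of "\<one>\<^bsub>K\<^esub>" "\<one>\<^bsub>K\<^esub>" x] that by (simp add: two)
  have eq: "y = x" if "x \<in> carrier K" "y \<in> carrier K" "x \<oplus>\<^bsub>K\<^esub> y = \<zero>\<^bsub>K\<^esub>" for x y
    using that dbl[of x] K.add.l_cancel[of x y x] by simp
  have e2: "unit_idem \<one>\<^bsub>K\<^esub> \<zero>\<^bsub>K\<^esub> \<in> carrier A"
      "unit_idem \<one>\<^bsub>K\<^esub> \<zero>\<^bsub>K\<^esub> \<otimes>\<^bsub>A\<^esub> unit_idem \<one>\<^bsub>K\<^esub> \<zero>\<^bsub>K\<^esub> = unit_idem \<one>\<^bsub>K\<^esub> \<zero>\<^bsub>K\<^esub>"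
    by (simp_all add: unit_idem_closed unit_idem_idem)
  have one: "\<one>\<^bsub>K\<^esub> \<oplus>\<^bsub>K\<^esub> \<zero>\<^bsub>K\<^esub> = \<one>\<^bsub>K\<^esub>" by simp
  interpret R: radical_square_zero_ring A K 3 "\<lambda>i f. characters f ! i" "\<lambda>j. E ! j"
  proof (unfold_locales, goal_cases)
    case (3 i)
    then show ?case by (auto simp: less_3 E_def zero_idem_idem f_idem_idem e2)
  next
    case (4 i)
    then show ?case by (auto simp: less_3 E_def zero_idem_idem f_idem_idem e2)
  next
    case (5 i j)
    then show ?case
      by (auto simp: less_3 E_def characters_zero_idem characters_f_idem characters_unit_idem)
  next
    case (6 a b)
    note ab = 6(1,2)
    have cl: "a 0 \<in> carrier K" "a 1 \<in> carrier K" "b 0 \<in> carrier K" "b 1 \<in> carrier K"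
      using coord_closed[OF ab(1)] coord_closed[OF ab(2)] by simp_all
    \<comment> \<open>The sums \<open>a 0 + a 1\<close> and \<open>b 0 + b 1\<close> vanish, so
      signs being irrelevant the entries agree; each coordinate of the product at \<open>1\<close>
      and \<open>g\<close> is then twice an element.\<close>
    have "a 1 = a 0" "b 1 = b 0"
      using 6(3)[of 2] 6(4)[of 2] cl eq[of "a 0" "a 1"] eq[of "b 0" "b 1"]
      by (simp_all add: characters_nth)
    then show ?case
      using 6 cl by (intro radical_square_zero_coord) (simp_all only: dbl K.m_closed)
  qed (use characters_hom characters_surj in auto)
  have idx: "j = 0 \<and> k = 0 \<or> j = 1 \<and> k = 0 \<or> j = 1 \<and> k = 1 \<or> j = 2 \<and> k = 0 \<or> j = 2 \<and> k = 1 \<or>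
      j = 2 \<and> k = 2 \<or> j = 2 \<and> k = 3"
    if "j < 3" "k < length ([[0], [2, 1], [1, 1, 2, 2]] ! j :: nat list)" for j k :: nat
    using that by (auto simp: less_3 less_Suc_eq)
  show ?thesis
  \<comment> \<open>On the kernel of the head functional \<open>x 0 + x 1\<close>, the functional
    \<open>x 0\<close> reads off the multiple of \<open>1 - g\<close>.\<close>
  proof (rule R.cartan_matrix_flags[where
        h = "\<lambda>j k x. [[augmentation x], [x 5, x 2], [x 3, x 4, x 0, x 0 \<oplus>\<^bsub>K\<^esub> x 1]] ! j ! k"], goal_cases)
    case (1 j k)
    then show ?case by (auto dest!: idx)
  next
    case (2 j k x)
    then show ?case
      using augmentation_closed[OF 2(3)] coord_closed[OF 2(3)] by (auto dest!: idx)
  next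
    case (3 j k x y)
    from idx[OF 3(1,2)] show ?case
      using coord_add[OF 3(3,4)] coord_add(2)[OF 3(3,4), simplified] coord_closed[OF 3(3)] coord_closed[OF 3(4)]
      by (elim disjE) (simp_all add: K.a_ac)
  next
    case (4 j k a x)
    note m = coord_mult_fixed[OF 4(3,4)]
    note v = 4(6)[of 1] 4(6)[of 2] 4(6)[of 3]
    from idx[OF 4(1,2)] show ?case
    proof (elim disjE conjE, goal_cases)
      case 1
      then show ?case using m(1) by simp
    next
      case 2
      then have "x \<otimes>\<^bsub>A\<^esub> f_idem = x" "x 2 = \<zero>\<^bsub>K\<^esub>" using 4(5) v by (simp_all add: E_def)
      with 2 show ?case using m(7) f_idem_fix[OF 4(4)] by simp
    next
      case 3
      then have "x \<otimes>\<^bsub>A\<^esub> f_idem = x" using 4(5) by (simp add: E_def)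
      with 3 show ?case using m(4) f_idem_fix[OF 4(4)] by simp
    next
      case 4
      then show ?case using m(5) v by simp
    next
      case 5
      then show ?case using m(6) v by simp
    next
      case 6
      have cl: "a 0 \<in> carrier K" "a 1 \<in> carrier K" "x 0 \<in> carrier K" "x 1 \<in> carrier K"
        using coord_closed[OF 4(3)] coord_closed[OF 4(4)] by simp_all
      \<comment> \<open>The head functional vanishes, so \<open>x 1 = x 0\<close>, and the
        coordinate of \<open>a x\<close> at \<open>0\<close> becomes
        \<open>(a 0 + a 1) x 0\<close>.\<close>
      have "x 0 \<oplus>\<^bsub>K\<^esub> x 1 = \<zero>\<^bsub>K\<^esub>" using 6 v by simp
      then have "x 1 = x 0" using cl eq[of "x 0" "x 1"] by simp
      then have "(a \<otimes>\<^bsub>A\<^esub> x) 0 = characters a ! 2 \<otimes>\<^bsub>K\<^esub> x 0"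
        using cl by (simp only: coord_mult[OF 4(3,4)] characters_nth K.l_distr)
      with 6 show ?case by simp
    next
      case 7
      then show ?case using m(2) by simp
    qed
  next
    case (5 j x)
    note xc = coord_closed[OF 5(2)]
    note v = 5(4)[of 0] 5(4)[of 1] 5(4)[of 2] 5(4)[of 3]
    from 5(1)[unfolded less_3] show ?case
    proof (elim disjE, goal_cases)
      case 1
      then show ?case
        using zero_idem_fix[OF 5(2)] 5(3) v by (intro coord_eqI 5) (simp_all add: E_def coord_zero coord_zero(2)[simplified])
    next
      case 2
      then show ?case
        using f_idem_fix[OF 5(2)] 5(3) v by (intro coord_eqI 5) (simp_all add: E_def coord_zero coord_zero(2)[simplified])
    next
      case 3
      then have f: "x \<otimes>\<^bsub>A\<^esub> unit_idem \<one>\<^bsub>K\<^esub> \<zero>\<^bsub>K\<^esub> = x"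
        and x: "x 3 = \<zero>\<^bsub>K\<^esub>" "x 4 = \<zero>\<^bsub>K\<^esub>" "x 0 = \<zero>\<^bsub>K\<^esub>" "x 0 \<oplus>\<^bsub>K\<^esub> x 1 = \<zero>\<^bsub>K\<^esub>"
        using 5(3) v by (simp_all add: E_def)
      note u = unit_idem_fix[OF K.one_closed K.zero_closed 5(2) f]
      have "x 1 = \<zero>\<^bsub>K\<^esub>" using x(3,4) xc by simp
      moreover have "x 2 = \<zero>\<^bsub>K\<^esub>" using u(3) unfolding x(4) by simp
      ultimately show ?case using u(6,7) x
        by (intro coord_eqI 5) (simp_all only: coord_zero A.zero_closed)
    qed
  next
    case (6 j k)
    from idx[OF 6(1,2)] show ?case
    proof (elim disjE conjE, goal_cases)
      case 1
      then show ?case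
        by (intro bexI[of _ zero_idem]) (simp_all add: E_def zero_idem_idem, simp add: zero_idem_def augmentation_coords)
    next
      case 2
      then show ?case
        using f_idem_fix_y by (intro bexI[of _ "coords [\<zero>\<^bsub>K\<^esub>, \<zero>\<^bsub>K\<^esub>, \<zero>\<^bsub>K\<^esub>, \<zero>\<^bsub>K\<^esub>, \<zero>\<^bsub>K\<^esub>, \<one>\<^bsub>K\<^esub>, \<ominus>\<^bsub>K\<^esub> \<one>\<^bsub>K\<^esub>]"])
          (auto simp: E_def less_Suc_eq)
    next
      case 3
      then show ?case
        by (intro bexI[of _ f_idem]) (simp_all add: E_def f_idem_idem, simp add: f_idem_def coords_coord)
    next
      case 4
      then show ?case
        using unit_idem_fix_x[OF K.one_closed K.zero_closed K.one_closed K.zero_closed one]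
        by (intro bexI) (auto simp: E_def less_Suc_eq)
    next
      case 5
      then show ?case
        using unit_idem_fix_x[OF K.zero_closed K.one_closed K.one_closed K.zero_closed one]
        by (intro bexI) (auto simp: E_def less_Suc_eq)
    next
      case 6
      \<comment> \<open>This is \<open>1 - g\<close>, the vector of the additional factor; it is
        fixed by right multiplication with \<open>1 - f\<close> because
        \<open>(1 - g) f = 0\<close>.\<close>
      define b where "b = coords [\<one>\<^bsub>K\<^esub>, \<ominus>\<^bsub>K\<^esub> \<one>\<^bsub>K\<^esub>, \<zero>\<^bsub>K\<^esub>, \<zero>\<^bsub>K\<^esub>, \<zero>\<^bsub>K\<^esub>, \<zero>\<^bsub>K\<^esub>, \<zero>\<^bsub>K\<^esub>]"
      have b: "b \<in> carrier A" by (simp add: b_def coords_closed)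
      have bc: "b 0 = \<one>\<^bsub>K\<^esub>" "b 1 = \<ominus>\<^bsub>K\<^esub> \<one>\<^bsub>K\<^esub>" "b 2 = \<zero>\<^bsub>K\<^esub>" "b 3 = \<zero>\<^bsub>K\<^esub>" "b 4 = \<zero>\<^bsub>K\<^esub>" "b 5 = \<zero>\<^bsub>K\<^esub>"
        "augmentation b = \<zero>\<^bsub>K\<^esub>" "\<one>\<^bsub>K\<^esub> \<oplus>\<^bsub>K\<^esub> \<ominus>\<^bsub>K\<^esub> \<one>\<^bsub>K\<^esub> = \<zero>\<^bsub>K\<^esub>"
        by (simp_all add: b_def coords_coord augmentation_coords K.r_neg)
      have "b \<otimes>\<^bsub>A\<^esub> unit_idem \<one>\<^bsub>K\<^esub> \<zero>\<^bsub>K\<^esub> = b"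
        by (rule coord_eqI) (simp_all only: mult_unit_idem[OF K.one_closed K.zero_closed b] A.m_closed b e2 bc
          K.r_one K.l_one K.r_null K.l_null K.r_zero K.l_zero K.one_closed K.zero_closed K.a_inv_closed one)
      with 6 b bc show ?case
        by (intro bexI[of _ b]) (auto simp: E_def less_Suc_eq)
    next
      case 7
      then show ?case
        using e2 unit_idem_coord[of "\<one>\<^bsub>K\<^esub>" "\<zero>\<^bsub>K\<^esub>"]
        by (intro bexI[of _ "unit_idem \<one>\<^bsub>K\<^esub> \<zero>\<^bsub>K\<^esub>"]) (auto simp: E_def)
    qed
  qed
qed

end

section \<open>Comparison of the complex numbers with the field of two elements\<close>

theorem corollary2p8:
  shows "\<exists>(M :: nat monoid) (K :: int ring) (C :: int mat) (D :: int mat).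
    monoid M \<and> finite (carrier M) \<and> field K \<and>
    cartan_matrix (monoid_algebra (ring_of_type_algebra :: complex ring) M) C \<and> det C \<noteq> 0 \<and>
    cartan_matrix (monoid_algebra K M) D \<and> det D = 0"
proof -
  let ?C = "mat 4 4 (\<lambda>(i, j). int (count_list ([[0], [2, 1], [1, 1, 2], [3]] ! j) i))"
  let ?D = "mat 3 3 (\<lambda>(i, j). int (count_list ([[0], [2, 1], [1, 1, 2, 2]] ! j) i))"
  let ?K = "residue_ring (int 2)"
  interpret C: M7_algebra "ring_of_type_algebra :: complex ring"
    by (intro M7_algebra.intro field_from_type_algebra)
  interpret residues_prime 2 ?K
    by unfold_locales auto
  have K: "field ?K" by (rule is_field)
  interpret K: M7_algebra ?K
    by (intro M7_algebra.intro K)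
  have "cartan_matrix C.A ?C"
    by (rule C.cartan_matrix_half[of "1/2"]) (simp_all add: ring_of_type_algebra_def)
  moreover have "cartan_matrix K.A ?D"
    by (rule K.cartan_matrix_char_two) (simp add: residue_ring_def)
  \<comment> \<open>Each of the three lists contains \<open>1\<close> and \<open>2\<close> equally
    often.\<close>
  moreover have "row ?D 1 = row ?D 2"
    by (rule eq_vecI) (auto simp: less_Suc_eq numeral_3_eq_3)
  then have "det ?D = 0"
    by (intro det_identical_rows[of _ 3 1 2]) simp_all
  moreover have "det ?C \<noteq> 0"
  proof
    \<comment> \<open>The inverse of \<open>?C\<close>, found blockwise: rows \<open>(-1, 2)\<close>
      and \<open>(1, -1)\<close> invert rows \<open>(1, 2)\<close> and \<open>(1, 1)\<close>. An
      integral right inverse shows that the determinant is nonzero without expanding it.\<close>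
    let ?B = "mat 4 4 (\<lambda>(i, j). [[1, 0, 0, 0], [0, -1, 2, 0], [0, 1, -1, 0], [0, 0, 0, 1]] ! i ! j) :: int mat"
    assume "det ?C = 0"
    moreover have "?C * ?B = 1\<^sub>m 4"
      by (rule eq_matI) (auto simp: scalar_prod_def less_Suc_eq eval_nat_numeral)
    then have "det ?C * det ?B = 1"
      using det_mult[of ?C 4 ?B] by simp
    ultimately show False by simp
  qed
  ultimately show ?thesis
    using monoid_M7 K
    by (intro exI[of _ M7] exI[of _ ?K] exI[of _ ?C] exI[of _ ?D]) (simp add: carrier_M7)
qed

end
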